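(* Let $\mathcal{X}$ be a Hilbert module over a pro-$C^*$-algebra $\mathcal{A}$ and let $K$ be an invertible element of $Hom^*_{\mathcal{A}}(\mathcal{X})$ such that $K$ and $K^{-1}$ are both uniformly bounded. Then every frame of multipliers $\{\xi_i\}_{i\in I}$ for $\mathcal{X}$ is a $K$-frame for $\mathcal{X}$.
   Context: A pro-$C^*$-algebra $\mathcal{A}$ is a complete Hausdorff topological $*$-algebra whose topology is given by its continuous $C^*$-seminorms $S(\mathcal{A})$. A Hilbert $\mathcal{A}$-module $\mathcal{X}$ is a left $\mathcal{A}$-module with an $\mathcal{A}$-valued inner product, complete for $\bar p_{\mathcal{X}}(\xi)=\sqrt{p(\langle\xi,\xi\rangle)}$. $Hom^*_{\mathcal{A}}(\mathcal{X})$ denotes adjointable bounded $\mathcal{A}$-module maps on $\mathcal{X}$; $T$ is uniformly bounded if there is a single $C>0$ with $\bar p_{\mathcal{X}}(T\xi)\le C\bar p_{\mathcal{X}}(\xi)$ for all $p,\xi$. A (standard) frame of multipliers is a sequence $\{\xi_i\}_{i\in I}$ ($I$ countable) with $\sum_i\langle\xi,\xi_i\rangle\langle\xi_i,\xi\rangle$ convergent in $\mathcal{A}$ and constants $C,D>0$ with $C\langle\xi,\xi\rangle\le\sum_i\langle\xi,\xi_i\rangle\langle\xi_i,\xi\rangle\le D\langle\xi,\xi\rangle$ for all $\xi\in\mathcal{X}$ (the inner products being those with values in $\mathcal{A}$ of the multiplier module containing $\mathcal{X}$). It is a $K$-frame if there are $A,B>0$ with $A\langle K^*\xi,K^*\xi\rangle\le\sum_i\langle\xi,\xi_i\rangle\langle\xi_i,\xi\rangle\le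 B\langle\xi,\xi\rangle$ for all $\xi\in\mathcal{X}$. *)

theory Defs
  imports "HOL-Analysis.Analysis"
begin

(* The ring operations (+, *, 0, -) come from the type class ring (not necessarily unital);
   the remaining structure is recorded explicitly. *)
record 'a pro_alg =
  smul :: "complex \<Rightarrow> 'a \<Rightarrow> 'a"
  invol :: "'a \<Rightarrow> 'a"
  sn :: "('a \<Rightarrow> real) set"

definition complex_vs :: "(complex \<Rightarrow> 'v::ab_group_add \<Rightarrow> 'v) \<Rightarrow> bool" where
  "complex_vs sm \<longleftrightarrow>
     (\<forall>c x y. sm c (x + y) = sm c x + sm c y) \<and>
     (\<forall>c d x. sm (c + d) x = sm c x + sm d x) \<and>
     (\<forall>c d x. sm (c * d) x = sm c (sm d x)) \<and>
     (\<forall>x. sm 1 x = x)"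

definition sn_converges :: "('v::ab_group_add \<Rightarrow> real) set \<Rightarrow> ('j \<Rightarrow> 'v) \<Rightarrow> 'v \<Rightarrow> 'j filter \<Rightarrow> bool" where
  "sn_converges N f l F \<longleftrightarrow> (\<forall>p\<in>N. \<forall>e>0. eventually (\<lambda>j. p (f j - l) < e) F)"

definition sn_cauchy :: "('v::ab_group_add \<Rightarrow> real) set \<Rightarrow> 'v filter \<Rightarrow> bool" where
  "sn_cauchy N F \<longleftrightarrow> (\<forall>p\<in>N. \<forall>e>0. eventually (\<lambda>(x, y). p (x - y) < e) (F \<times>\<^sub>F F))"

definition sn_complete :: "('v::ab_group_add \<Rightarrow> real) set \<Rightarrow> bool" where
  "sn_complete N \<longleftrightarrow> (\<forall>F. F \<noteq> bot \<and> sn_cauchy N F \<longrightarrow> (\<exists>l. sn_converges N (\<lambda>x. x) l F))"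

definition C_star_seminorm :: "'a::ring pro_alg \<Rightarrow> ('a \<Rightarrow> real) \<Rightarrow> bool" where
  "C_star_seminorm A p \<longleftrightarrow>
     (\<forall>x. 0 \<le> p x) \<and>
     (\<forall>x y. p (x + y) \<le> p x + p y) \<and>
     (\<forall>c x. p (smul A c x) = cmod c * p x) \<and>
     (\<forall>x y. p (x * y) \<le> p x * p y) \<and>
     (\<forall>x. p (invol A x * x) = (p x)\<^sup>2)"

definition pro_C_star_algebra :: "'a::ring pro_alg \<Rightarrow> bool" where
  "pro_C_star_algebra A \<longleftrightarrow>
     complex_vs (smul A) \<and>
     (\<forall>c x y. smul A c (x * y) = smul A c x * y \<and> smul A c (x * y) = x * smul A c y) \<and>
     (\<forall>x y. invol A (x + y) = invol A x + invol A y) \<and>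
     (\<forall>x y. invol A (x * y) = invol A y * invol A x) \<and>
     (\<forall>c x. invol A (smul A c x) = smul A (cnj c) (invol A x)) \<and>
     (\<forall>x. invol A (invol A x) = x) \<and>
     (\<forall>p\<in>sn A. C_star_seminorm A p) \<and>
     \<comment> \<open>sn A consists of ALL C*-seminorms continuous for the topology it generates\<close>
     (\<forall>q. C_star_seminorm A q \<and>
          (\<exists>F c. finite F \<and> F \<subseteq> sn A \<and> (\<forall>x. q x \<le> c * (\<Sum>p\<in>F. p x))) \<longrightarrow> q \<in> sn A) \<and>
     \<comment> \<open>Hausdorff\<close>
     (\<forall>x. x \<noteq> 0 \<longrightarrow> (\<exists>p\<in>sn A. p x \<noteq> 0)) \<and>
     \<comment> \<open>complete\<close>
     sn_complete (sn A)"

definition positive :: "'a::ring pro_alg \<Rightarrow> 'a \<Rightarrow> bool" where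
  "positive A a \<longleftrightarrow> (\<exists>b. a = invol A b * b)"

definition pleq :: "'a::ring pro_alg \<Rightarrow> 'a \<Rightarrow> 'a \<Rightarrow> bool" where
  "pleq A a b \<longleftrightarrow> positive A (b - a)"

record ('a, 'x) hmod =
  csm :: "complex \<Rightarrow> 'x \<Rightarrow> 'x"
  asm :: "'a \<Rightarrow> 'x \<Rightarrow> 'x"
  ip :: "'x \<Rightarrow> 'x \<Rightarrow> 'a"

definition pbar :: "('a, 'x) hmod \<Rightarrow> ('a \<Rightarrow> real) \<Rightarrow> 'x \<Rightarrow> real" where
  "pbar X p \<xi> = sqrt (p (ip X \<xi> \<xi>))"

definition hilbert_module :: "'a::ring pro_alg \<Rightarrow> ('a, 'x::ab_group_add) hmod \<Rightarrow> bool" where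
  "hilbert_module A X \<longleftrightarrow>
     pro_C_star_algebra A \<and>
     complex_vs (csm X) \<and>
     (\<forall>a x y. asm X a (x + y) = asm X a x + asm X a y) \<and>
     (\<forall>a b x. asm X (a + b) x = asm X a x + asm X b x) \<and>
     (\<forall>a b x. asm X (a * b) x = asm X a (asm X b x)) \<and>
     (\<forall>c a x. csm X c (asm X a x) = asm X (smul A c a) x \<and> csm X c (asm X a x) = asm X a (csm X c x)) \<and>
     (\<forall>x y z. ip X (x + y) z = ip X x z + ip X y z) \<and>
     (\<forall>a x y. ip X (asm X a x) y = a * ip X x y) \<and>
     (\<forall>c x y. ip X (csm X c x) y = smul A c (ip X x y)) \<and>
     (\<forall>x y. invol A (ip X x y) = ip X y x) \<and>
     (\<forall>x. positive A (ip X x x)) \<and>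
     (\<forall>x. ip X x x = 0 \<longrightarrow> x = 0) \<and>
     sn_complete {pbar X p | p. p \<in> sn A}"

definition module_map_XX :: "'a::ring pro_alg \<Rightarrow> ('a, 'x::ab_group_add) hmod \<Rightarrow> ('x \<Rightarrow> 'x) \<Rightarrow> bool" where
  "module_map_XX A X T \<longleftrightarrow>
     (\<forall>x y. T (x + y) = T x + T y) \<and> (\<forall>c x. T (csm X c x) = csm X c (T x)) \<and>
     (\<forall>a x. T (asm X a x) = asm X a (T x))"

definition in_Hom_adj :: "'a::ring pro_alg \<Rightarrow> ('a, 'x::ab_group_add) hmod \<Rightarrow> ('x \<Rightarrow> 'x) \<Rightarrow> ('x \<Rightarrow> 'x) \<Rightarrow> bool" where
  "in_Hom_adj A X T Tadj \<longleftrightarrow>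
     module_map_XX A X T \<and> module_map_XX A X Tadj \<and>
     (\<forall>x y. ip X (T x) y = ip X x (Tadj y)) \<and>
     (\<forall>p\<in>sn A. \<exists>C\<ge>0. \<forall>x. pbar X p (T x) \<le> C * pbar X p x) \<and>
     (\<forall>p\<in>sn A. \<exists>C\<ge>0. \<forall>x. pbar X p (Tadj x) \<le> C * pbar X p x)"

definition uniformly_bounded :: "'a::ring pro_alg \<Rightarrow> ('a, 'x) hmod \<Rightarrow> ('x \<Rightarrow> 'x) \<Rightarrow> bool" where
  "uniformly_bounded A X T \<longleftrightarrow> (\<exists>C>0. \<forall>p\<in>sn A. \<forall>x. pbar X p (T x) \<le> C * pbar X p x)"

(* ---------- Multiplier module M(X) = Hom*_A(A, X) ----------
   A is a Hilbert A-module with <a,b> = a * b^*.  A multiplier is a pair (T, Tadj) with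
   T : A \<rightarrow> X, Tadj : X \<rightarrow> A bounded A-module maps, <T a, \<eta>>_X = <a, Tadj \<eta>>_A.
   X embeds via \<xi> \<mapsto> (\<lambda>a. a\<xi>, \<lambda>\<eta>. <\<eta>,\<xi>>), and for \<xi> \<in> X, M \<in> M(X):
   <\<xi>, M> = Tadj \<xi> \<in> A and <M, \<xi>> = (Tadj \<xi>)^*. *)
definition is_multiplier :: "'a::ring pro_alg \<Rightarrow> ('a, 'x::ab_group_add) hmod \<Rightarrow> ('a \<Rightarrow> 'x) \<times> ('x \<Rightarrow> 'a) \<Rightarrow> bool" where
  "is_multiplier A X M \<longleftrightarrow>
     (\<forall>a b. fst M (a + b) = fst M a + fst M b) \<and> (\<forall>c a. fst M (smul A c a) = csm X c (fst M a)) \<and>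
     (\<forall>a b. fst M (a * b) = asm X a (fst M b)) \<and>
     (\<forall>x y. snd M (x + y) = snd M x + snd M y) \<and> (\<forall>c x. snd M (csm X c x) = smul A c (snd M x)) \<and>
     (\<forall>a x. snd M (asm X a x) = a * snd M x) \<and>
     (\<forall>a y. ip X (fst M a) y = a * invol A (snd M y)) \<and>
     (\<forall>p\<in>sn A. \<exists>C\<ge>0. \<forall>a. pbar X p (fst M a) \<le> C * p a) \<and>
     (\<forall>p\<in>sn A. \<exists>C\<ge>0. \<forall>x. p (snd M x) \<le> C * pbar X p x)"

definition ip_XM :: "('x \<Rightarrow> 'a) \<Rightarrow> 'x \<Rightarrow> 'a" where
  "ip_XM Madj \<xi> = Madj \<xi>"

definition ip_MX :: "'a pro_alg \<Rightarrow> ('x \<Rightarrow> 'a) \<Rightarrow> 'x \<Rightarrow> 'a" where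
  "ip_MX A Madj \<xi> = invol A (Madj \<xi>)"

definition has_sum_in :: "'a::ring pro_alg \<Rightarrow> ('i \<Rightarrow> 'a) \<Rightarrow> 'i set \<Rightarrow> 'a \<Rightarrow> bool" where
  "has_sum_in A g I s \<longleftrightarrow> sn_converges (sn A) (\<lambda>J. \<Sum>i\<in>J. g i) s (finite_subsets_at_top I)"

definition frame_term :: "'a::ring pro_alg \<Rightarrow> ('i \<Rightarrow> ('a \<Rightarrow> 'x) \<times> ('x \<Rightarrow> 'a)) \<Rightarrow> 'x \<Rightarrow> 'i \<Rightarrow> 'a" where
  "frame_term A \<Xi> \<xi> i = ip_XM (snd (\<Xi> i)) \<xi> * ip_MX A (snd (\<Xi> i)) \<xi>"

definition frame_of_multipliers :: "'a::ring pro_alg \<Rightarrow> ('a, 'x::ab_group_add) hmod \<Rightarrow> 'i set \<Rightarrow> ('i \<Rightarrow> ('a \<Rightarrow> 'x) \<times> ('x \<Rightarrow> 'a)) \<Rightarrow> bool" where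
  "frame_of_multipliers A X I \<Xi> \<longleftrightarrow>
     countable I \<and> (\<forall>i\<in>I. is_multiplier A X (\<Xi> i)) \<and>
     (\<exists>C D. C > 0 \<and> D > 0 \<and>
        (\<forall>\<xi>. \<exists>s. has_sum_in A (frame_term A \<Xi> \<xi>) I s \<and>
              pleq A (smul A (complex_of_real C) (ip X \<xi> \<xi>)) s \<and>
              pleq A s (smul A (complex_of_real D) (ip X \<xi> \<xi>))))"

definition K_frame :: "'a::ring pro_alg \<Rightarrow> ('a, 'x::ab_group_add) hmod \<Rightarrow> ('x \<Rightarrow> 'x) \<Rightarrow> 'i set \<Rightarrow> ('i \<Rightarrow> ('a \<Rightarrow> 'x) \<times> ('x \<Rightarrow> 'a)) \<Rightarrow> bool" where
  "K_frame A X Kadj I \<Xi> \<longleftrightarrow>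
     countable I \<and> (\<forall>i\<in>I. is_multiplier A X (\<Xi> i)) \<and>
     (\<exists>a b. a > 0 \<and> b > 0 \<and>
        (\<forall>\<xi>. \<exists>s. has_sum_in A (frame_term A \<Xi> \<xi>) I s \<and>
              pleq A (smul A (complex_of_real a) (ip X (Kadj \<xi>) (Kadj \<xi>))) s \<and>
              pleq A s (smul A (complex_of_real b) (ip X \<xi> \<xi>))))"

end

theory Submission
  imports Defs
begin

text \<open>
  Put \<open>T = K K\<^sup>*\<close> and \<open>\<eta> = K\<^sup>* \<xi>\<close>. If \<open>\<langle>K \<eta>, K \<eta>\<rangle> \<le> M \<langle>\<eta>, \<eta>\<rangle>\<close> for all \<open>\<eta>\<close>, then
  \<open>M (M \<langle>\<xi>, \<xi>\<rangle> - \<langle>K\<^sup>* \<xi>, K\<^sup>* \<xi>\<rangle>) = \<langle>(M - T) \<xi>, (M - T) \<xi>\<rangle> + (M \<langle>\<eta>, \<eta>\<rangle> - \<langle>K \<eta>, K \<eta>\<rangle>)\<close>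
  is positive, and the lower frame bound passes from \<open>\<xi>\<close> to \<open>K\<^sup>* \<xi>\<close>. Two facts about the algebra are
  needed: sums of elements \<open>b\<^sup>* b\<close> are again of this form, and the seminorm inequality
  \<open>p (a d a\<^sup>*) \<le> M p (a g a\<^sup>*)\<close> for all \<open>a\<close> and \<open>p\<close> implies \<open>d \<le> M g\<close>.

  Both are proved first in the unital C*-algebra of uniformly bounded adjointable operators on the
  algebra, without spectral theory: square roots come from the iteration \<open>y \<mapsto> (k + y\<^sup>2) / 2\<close>, and
  a self-adjoint \<open>h\<close> counts as positive if \<open>\<parallel>t - h\<parallel> \<le> t\<close> for some \<open>t\<close>, which makes closure under sums
  obvious. General elements are reduced to bounded ones by multiplying with the contractive resolvents
  \<open>(1 + h\<^sup>2)\<^sup>-\<^sup>1\<close>, which exist for every self-adjoint \<open>h\<close> by completeness.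
\<close>

section \<open>Positivity in unital C*-algebras\<close>

primrec sqrt_bound :: "nat \<Rightarrow> real" where
  "sqrt_bound 0 = 0"
| "sqrt_bound (Suc n) = (1 + (sqrt_bound n)\<^sup>2) / 2"

lemma sqrt_bound_range: "0 \<le> sqrt_bound n \<and> sqrt_bound n \<le> 1"
proof (induction n)
  case (Suc n)
  then have "(sqrt_bound n)\<^sup>2 \<le> 1" by (simp add: power_le_one)
  then show ?case by simp
qed simp

lemma sqrt_bound_le_one: "sqrt_bound n \<le> 1"
  using sqrt_bound_range by auto

lemma sqrt_bound_incseq: "incseq sqrt_bound"
proof (rule incseq_SucI)
  fix n
  have "0 \<le> (1 - sqrt_bound n)\<^sup>2" by simp
  then show "sqrt_bound n \<le> sqrt_bound (Suc n)"
    by (simp add: power2_eq_square algebra_simps)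
qed

text \<open>The recursion is the case k = 1 of \<open>sqrt_iter\<close>; its only fixed point is the
  double root 1.\<close>

lemma sqrt_bound_tendsto: "sqrt_bound \<longlonglongrightarrow> 1"
proof -
  obtain L where L: "sqrt_bound \<longlonglongrightarrow> L"
    by (rule incseq_convergent[OF sqrt_bound_incseq, of 1]) (auto simp: sqrt_bound_le_one)
  have "(\<lambda>n. sqrt_bound (Suc n)) \<longlonglongrightarrow> (1 + L\<^sup>2) / 2"
    unfolding sqrt_bound.simps by (intro tendsto_intros L) simp
  with LIMSEQ_Suc[OF L] have "L = (1 + L\<^sup>2) / 2" by (rule LIMSEQ_unique)
  then have "(L - 1)\<^sup>2 = 0" by (simp add: power2_eq_square algebra_simps)
  then show ?thesis using L by simp
qed

lemma commute_mult:
  fixes a b x :: "'b::semigroup_mult"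
  assumes "a * x = x * a" "b * x = x * b"
  shows "a * b * x = x * (a * b)"
proof -
  have "a * b * x = a * x * b" by (simp add: mult.assoc assms(2))
  then show ?thesis by (simp add: mult.assoc assms(1))
qed

locale unital_cstar =
  fixes B :: "'b::{ring,monoid_mult} set" and st :: "'b \<Rightarrow> 'b" and nm :: "'b \<Rightarrow> real" and sc :: "complex \<Rightarrow> 'b"
  assumes one_mem [simp]: "1 \<in> B"
    and diff_mem [simp]: "\<lbrakk>x \<in> B; y \<in> B\<rbrakk> \<Longrightarrow> x - y \<in> B"
    and mult_mem [simp]: "\<lbrakk>x \<in> B; y \<in> B\<rbrakk> \<Longrightarrow> x * y \<in> B"
    and st_mem [simp]: "x \<in> B \<Longrightarrow> st x \<in> B"
    and sc_mem [simp]: "sc c \<in> B"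
    and sc_add: "sc (a + b) = sc a + sc b"
    and sc_mult: "sc (a * b) = sc a * sc b"
    and sc_1 [simp]: "sc 1 = 1"
    and sc_comm: "x \<in> B \<Longrightarrow> x * sc c = sc c * x"
    and st_add: "\<lbrakk>x \<in> B; y \<in> B\<rbrakk> \<Longrightarrow> st (x + y) = st x + st y"
    and st_mult: "\<lbrakk>x \<in> B; y \<in> B\<rbrakk> \<Longrightarrow> st (x * y) = st y * st x"
    and st_st [simp]: "x \<in> B \<Longrightarrow> st (st x) = x"
    and st_sc [simp]: "st (sc c) = sc (cnj c)"
    and nm_nonneg [simp]: "x \<in> B \<Longrightarrow> 0 \<le> nm x"
    and nm_eq_0D: "\<lbrakk>x \<in> B; nm x = 0\<rbrakk> \<Longrightarrow> x = 0"
    and nm_add: "\<lbrakk>x \<in> B; y \<in> B\<rbrakk> \<Longrightarrow> nm (x + y) \<le> nm x + nm y"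
    and nm_mult: "\<lbrakk>x \<in> B; y \<in> B\<rbrakk> \<Longrightarrow> nm (x * y) \<le> nm x * nm y"
    and nm_sc_mult: "x \<in> B \<Longrightarrow> nm (sc c * x) = cmod c * nm x"
    and nm_star: "x \<in> B \<Longrightarrow> nm (st x * x) = (nm x)\<^sup>2"
    and complete: "\<lbrakk>\<And>n. f n \<in> B; \<forall>e>0. \<exists>N. \<forall>m\<ge>N. \<forall>n\<ge>N. nm (f m - f n) < e\<rbrakk>
      \<Longrightarrow> \<exists>l\<in>B. (\<lambda>n. nm (f n - l)) \<longlonglongrightarrow> 0"
begin

lemma zero_mem [simp]: "0 \<in> B"
  using diff_mem[OF one_mem one_mem] by simp

lemma minus_mem [simp]: "x \<in> B \<Longrightarrow> - x \<in> B"
  using diff_mem[OF zero_mem] by fastforce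

lemma add_mem [simp]: "\<lbrakk>x \<in> B; y \<in> B\<rbrakk> \<Longrightarrow> x + y \<in> B"
  using diff_mem[of x "- y"] by simp

lemma sc_0 [simp]: "sc 0 = 0"
  using sc_add[of 0 0] by simp

lemma sc_minus: "sc (- c) = - sc c"
  using sc_add[of c "- c"] by (simp add: eq_neg_iff_add_eq_0 add.commute)

lemma sc_diff: "sc (a - b) = sc a - sc b"
  using sc_add[of a "- b"] by (simp add: sc_minus)

lemma sc_collapse: "sc a * (sc b * x) = sc (a * b) * x"
  by (simp add: sc_mult mult.assoc)

lemma sc_half_double [simp]: "sc (1/2) * x + sc (1/2) * x = x"
  using sc_add[of "1/2" "1/2"] by (simp flip: distrib_right)

lemma st_0 [simp]: "st 0 = 0"
  using st_sc[of 0] by simp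

lemma st_1 [simp]: "st 1 = 1"
  using st_sc[of 1] by simp

lemma st_minus: "x \<in> B \<Longrightarrow> st (- x) = - st x"
  using st_add[of x "- x"] by (simp add: eq_neg_iff_add_eq_0 add.commute)

lemma st_diff: "\<lbrakk>x \<in> B; y \<in> B\<rbrakk> \<Longrightarrow> st (x - y) = st x - st y"
  using st_add[of x "- y"] by (simp add: st_minus)

lemma nm_0 [simp]: "nm 0 = 0"
  using nm_sc_mult[of 0 0] by simp

lemma nm_minus: "x \<in> B \<Longrightarrow> nm (- x) = nm x"
  using nm_sc_mult[of x "- 1"] by (simp add: sc_minus)

lemma nm_diff: "\<lbrakk>x \<in> B; y \<in> B\<rbrakk> \<Longrightarrow> nm (x - y) \<le> nm x + nm y"
  using nm_add[of x "- y"] by (simp add: nm_minus)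

lemma nm_diff_commute: "\<lbrakk>x \<in> B; y \<in> B\<rbrakk> \<Longrightarrow> nm (x - y) = nm (y - x)"
  using nm_minus[of "x - y"] by simp

text \<open>The C*-identity gives \<open>(nm y)^2 \<le> nm (st y) * nm y\<close>; cancel
  \<open>nm y\<close>, then use the result for \<open>st x\<close> as well.\<close>

lemma nm_st [simp]:
  assumes "x \<in> B" shows "nm (st x) = nm x"
proof -
  have *: "nm y \<le> nm (st y)" if "y \<in> B" for y
  proof (cases "nm y = 0")
    case False
    then have "nm y > 0" using that by (simp add: order.not_eq_order_implies_strict)
    moreover have "nm y * nm y \<le> nm (st y) * nm y"
      using nm_mult[of "st y" y] nm_star[of y] that by (simp add: power2_eq_square)
    ultimately show ?thesis by simp
  qed (use that in simp)
  from *[OF assms] *[of "st x"] assms show ?thesis by simp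
qed

lemma nm_1: "nm 1 \<le> 1"
proof -
  have "nm 1 * nm 1 = nm 1" using nm_star[of 1] by (simp add: power2_eq_square)
  then show ?thesis by (cases "nm 1 = 0") auto
qed

lemma nm_sc: "nm (sc c) \<le> cmod c"
  using nm_sc_mult[of 1 c] nm_1 by (simp add: mult_left_le)

lemma nm_mult_le: "\<lbrakk>x \<in> B; y \<in> B; nm x \<le> a; nm y \<le> b\<rbrakk> \<Longrightarrow> nm (x * y) \<le> a * b"
  by (meson mult_mono nm_mult nm_nonneg order_trans)

lemma nm_le_imp_eq_0:
  assumes "x \<in> B" "\<And>n::nat. nm x \<le> g n" "g \<longlonglongrightarrow> 0"
  shows "x = 0"
proof -
  have "nm x \<le> 0" using assms(2,3) by (intro LIMSEQ_le_const) auto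
  then show ?thesis using assms(1) nm_nonneg[OF assms(1)] nm_eq_0D by simp
qed

lemma star_mult_self_eq_0D: "\<lbrakk>x \<in> B; st x * x = 0\<rbrakk> \<Longrightarrow> x = 0"
  using nm_star[of x] nm_eq_0D[of x] by simp

lemma square_eq_0D: "\<lbrakk>x \<in> B; st x = x; x * x = 0\<rbrakk> \<Longrightarrow> x = 0"
  using star_mult_self_eq_0D by metis

section \<open>Square roots of 1 - k by iteration\<close>

primrec sqrt_iter :: "'b \<Rightarrow> nat \<Rightarrow> 'b" where
  "sqrt_iter k 0 = 0"
| "sqrt_iter k (Suc n) = sc (1/2) * (k + sqrt_iter k n * sqrt_iter k n)"

lemma sqrt_iter_mem [simp]: "k \<in> B \<Longrightarrow> sqrt_iter k n \<in> B"
  by (induction n) auto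

lemma sqrt_iter_commute:
  assumes "k \<in> B" "x \<in> B" "k * x = x * k"
  shows "sqrt_iter k n * x = x * sqrt_iter k n"
proof (induction n)
  case (Suc n)
  let ?y = "sqrt_iter k n"
  have "(k + ?y * ?y) * x = x * (k + ?y * ?y)"
    using commute_mult[OF Suc Suc] assms(3) by (simp add: distrib_left distrib_right)
  moreover have "sc (1/2) * x = x * sc (1/2)" using sc_comm[OF assms(2)] by simp
  ultimately show ?case using commute_mult by (simp del: distrib_left distrib_right)
qed simp

lemma sqrt_iter_st:
  assumes "k \<in> B" "st k = k"
  shows "st (sqrt_iter k n) = sqrt_iter k n"
  by (induction n) (use assms in \<open>simp_all add: st_mult st_add sc_comm\<close>)

lemma nm_sqrt_iter:
  assumes "k \<in> B" "nm k \<le> 1"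
  shows "nm (sqrt_iter k n) \<le> sqrt_bound n"
proof (induction n)
  case (Suc n)
  let ?y = "sqrt_iter k n"
  have "nm (?y * ?y) \<le> sqrt_bound n * sqrt_bound n"
    using assms Suc by (intro nm_mult_le) auto
  then have "nm (k + ?y * ?y) \<le> 1 + sqrt_bound n * sqrt_bound n"
    using nm_add[of k "?y * ?y"] assms by simp
  then show ?case using assms by (simp add: nm_sc_mult power2_eq_square)
qed (use assms in simp)

text \<open>Consecutive iterates commute, so the difference of their squares factors as sum times
  difference. Both factors are bounded by their scalar counterparts, and the scalar recursion
  factors in the same way.\<close>

lemma nm_sqrt_iter_step:
  assumes "k \<in> B" "nm k \<le> 1"
  shows "nm (sqrt_iter k (Suc n) - sqrt_iter k n) \<le> sqrt_bound (Suc n) - sqrt_bound n"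
proof (induction n)
  case 0
  then show ?case using assms by (simp add: nm_sc_mult)
next
  case (Suc n)
  let ?x = "sqrt_iter k n" and ?y = "sqrt_iter k (Suc n)"
  have "?y * ?x = ?x * ?y"
    using assms by (intro sqrt_iter_commute) (auto simp: sqrt_iter_commute)
  then have "?y * ?y - ?x * ?x = (?y + ?x) * (?y - ?x)"
    by (simp add: algebra_simps del: sqrt_iter.simps)
  moreover have "nm (?y + ?x) \<le> sqrt_bound (Suc n) + sqrt_bound n"
    using nm_add[of ?y ?x] nm_sqrt_iter[OF assms, of n] nm_sqrt_iter[OF assms, of "Suc n"] assms
    by (simp del: sqrt_iter.simps sqrt_bound.simps)
  ultimately have "nm (?y * ?y - ?x * ?x)
      \<le> (sqrt_bound (Suc n) + sqrt_bound n) * (sqrt_bound (Suc n) - sqrt_bound n)"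
    using assms Suc by (simp add: nm_mult_le del: sqrt_iter.simps sqrt_bound.simps)
  moreover have "sqrt_iter k (Suc (Suc n)) - ?y = sc (1/2) * (?y * ?y - ?x * ?x)"
    by (simp add: algebra_simps)
  ultimately have "nm (sqrt_iter k (Suc (Suc n)) - ?y)
      \<le> (1/2) * ((sqrt_bound (Suc n) + sqrt_bound n) * (sqrt_bound (Suc n) - sqrt_bound n))"
    using assms by (simp add: nm_sc_mult del: sqrt_iter.simps sqrt_bound.simps)
  also have "\<dots> = sqrt_bound (Suc (Suc n)) - sqrt_bound (Suc n)"
    unfolding sqrt_bound.simps(2)[of "Suc n"] by (simp add: field_simps power2_eq_square)
  finally show ?case .
qed

lemma convergent_if_dominated:
  fixes G :: "nat \<Rightarrow> real"
  assumes f: "\<And>n. f n \<in> B" and step: "\<And>n. nm (f (Suc n) - f n) \<le> G (Suc n) - G n"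
    and G: "G \<longlonglongrightarrow> L"
  obtains l where "l \<in> B" "(\<lambda>n. nm (f n - l)) \<longlonglongrightarrow> 0"
proof -
  have *: "nm (f (n + j) - f n) \<le> G (n + j) - G n" for n j
  proof (induction j)
    case (Suc j)
    have "f (n + Suc j) - f n = (f (Suc (n + j)) - f (n + j)) + (f (n + j) - f n)" by simp
    then show ?case
      using nm_add[of "f (Suc (n + j)) - f (n + j)" "f (n + j) - f n"] step[of "n + j"] Suc f by simp
  qed simp
  have bound: "nm (f m - f n) \<le> \<bar>G m - G n\<bar>" for m n
  proof (cases "n \<le> m")
    case True
    then obtain j where "m = n + j" by (metis le_add_diff_inverse)
    then show ?thesis using *[of n j] by simp
  next
    case False
    then obtain j where "n = m + j" by (metis le_add_diff_inverse nat_le_linear)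
    then show ?thesis using *[of m j] nm_diff_commute f by simp
  qed
  have "Cauchy G" using G by (rule LIMSEQ_imp_Cauchy)
  then have "\<forall>e>0. \<exists>N. \<forall>m\<ge>N. \<forall>n\<ge>N. nm (f m - f n) < e"
    unfolding Cauchy_def dist_real_def using bound by (meson le_less_trans)
  with complete[of f] f that show thesis by blast
qed

text \<open>A fixed point satisfies 2 y = k + y^2, which is (1 - y)^2 = 1 - k after completing the
  square.\<close>

lemma sqrt_iter_convergent:
  assumes "k \<in> B" "nm k \<le> 1"
  obtains y where "y \<in> B" "nm y \<le> 1" "(\<lambda>n. nm (sqrt_iter k n - y)) \<longlonglongrightarrow> 0" "(1 - y) * (1 - y) = 1 - k"
proof -
  obtain y where y: "y \<in> B" "(\<lambda>n. nm (sqrt_iter k n - y)) \<longlonglongrightarrow> 0"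
    using convergent_if_dominated[of "sqrt_iter k" sqrt_bound] assms sqrt_bound_tendsto
      nm_sqrt_iter_step sqrt_iter_mem by blast
  let ?d = "\<lambda>n. nm (sqrt_iter k n - y)"
  have le1: "nm (sqrt_iter k n) \<le> 1" for n
    using nm_sqrt_iter[OF assms, of n] sqrt_bound_le_one[of n] by simp
  have "nm y \<le> 1 + ?d n" for n
    using nm_diff[of "sqrt_iter k n" "sqrt_iter k n - y"] le1[of n] assms y(1) by simp
  moreover have "(\<lambda>n. 1 + ?d n) \<longlonglongrightarrow> 1 + 0" by (intro tendsto_intros y(2))
  ultimately have y1: "nm y \<le> 1" using LIMSEQ_le_const[of "\<lambda>n. 1 + ?d n" "1 + 0" "nm y"] by auto
  have "y - sc (1/2) * (k + y * y) = 0"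
  proof (rule nm_le_imp_eq_0)
    fix n
    let ?x = "sqrt_iter k n"
    have "?x * ?x - y * y = ?x * (?x - y) + (?x - y) * y" by (simp add: algebra_simps)
    moreover have "nm (?x * (?x - y)) \<le> 1 * ?d n" "nm ((?x - y) * y) \<le> ?d n * 1"
      by (rule nm_mult_le; use assms y y1 le1 in simp)+
    ultimately have "nm (?x * ?x - y * y) \<le> 2 * ?d n"
      using nm_add[of "?x * (?x - y)" "(?x - y) * y"] assms y by simp
    then have half: "nm (sc (1/2) * (?x * ?x - y * y)) \<le> ?d n" using assms y by (simp add: nm_sc_mult)
    \<comment> \<open>The recursion expresses k / 2 through the next iterate, so the fixed point
      defect is controlled by two consecutive errors.\<close>
    have "y - sc (1/2) * (k + y * y) = sc (1/2) * (?x * ?x - y * y) - (sqrt_iter k (Suc n) - y)"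
      by (simp add: algebra_simps)
    moreover have "nm (sc (1/2) * (?x * ?x - y * y) - (sqrt_iter k (Suc n) - y)) \<le> ?d n + ?d (Suc n)"
      using nm_diff[of "sc (1/2) * (?x * ?x - y * y)" "sqrt_iter k (Suc n) - y"] half assms y
      by (simp del: sqrt_iter.simps)
    ultimately show "nm (y - sc (1/2) * (k + y * y)) \<le> ?d n + ?d (Suc n)" by metis
  next
    show "(\<lambda>n. ?d n + ?d (Suc n)) \<longlonglongrightarrow> 0"
      using tendsto_add[OF y(2) LIMSEQ_Suc[OF y(2)]] by simp
  qed (use assms y in simp)
  then have "y + y = k + y * y" by (metis eq_iff_diff_eq_0 sc_half_double)
  then have "(1 - y) * (1 - y) = 1 - k" by (simp add: algebra_simps)
  with y y1 that show thesis by blast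
qed

abbreviation rs :: "real \<Rightarrow> 'b" where "rs t \<equiv> sc (complex_of_real t)"

lemma rs_comm: "x \<in> B \<Longrightarrow> rs t * x = x * rs t"
  by (simp add: sc_comm)

lemma rs_mult_cancel: "c \<noteq> 0 \<Longrightarrow> rs c * (rs (1 / c) * x) = x"
  by (simp add: sc_collapse flip: of_real_mult)

text \<open>Self-adjointness and commutation with the commutant of k hold for every iterate and pass
  to the norm limit.\<close>

lemma sqrt_one_minus:
  assumes k: "k \<in> B" "nm k \<le> 1" "st k = k"
  obtains y where "y \<in> B" "st y = y" "nm y \<le> 1" "(\<lambda>n. nm (sqrt_iter k n - y)) \<longlonglongrightarrow> 0"
    "(1 - y) * (1 - y) = 1 - k" "\<And>x. \<lbrakk>x \<in> B; k * x = x * k\<rbrakk> \<Longrightarrow> y * x = x * y"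
proof -
  obtain y where y: "y \<in> B" "nm y \<le> 1" "(\<lambda>n. nm (sqrt_iter k n - y)) \<longlonglongrightarrow> 0"
    "(1 - y) * (1 - y) = 1 - k"
    using sqrt_iter_convergent[OF k(1,2)] by blast
  let ?d = "\<lambda>n. nm (sqrt_iter k n - y)"
  have "st y - y = 0"
  proof (rule nm_le_imp_eq_0)
    fix n
    have "st y - y = (sqrt_iter k n - y) - st (sqrt_iter k n - y)"
      using k y by (simp add: st_diff sqrt_iter_st)
    also have "nm \<dots> \<le> 2 * ?d n"
      using nm_diff[of "sqrt_iter k n - y" "st (sqrt_iter k n - y)"] k y by simp
    finally show "nm (st y - y) \<le> 2 * ?d n" .
    show "(\<lambda>n. 2 * ?d n) \<longlonglongrightarrow> 0" using tendsto_mult_right_zero[OF y(3)] .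
  qed (use y in simp)
  moreover have "y * x = x * y" if x: "x \<in> B" "k * x = x * k" for x
  proof -
    have "y * x - x * y = 0"
    proof (rule nm_le_imp_eq_0)
      fix n
      let ?e = "sqrt_iter k n - y"
      have "y * x - x * y = x * ?e - ?e * x"
        using sqrt_iter_commute[OF k(1) x, of n] by (simp add: algebra_simps)
      also have "nm \<dots> \<le> nm (x * ?e) + nm (?e * x)"
        using k y x by (intro nm_diff) auto
      also have "\<dots> \<le> 2 * nm x * ?d n"
        using nm_mult[of x ?e] nm_mult[of ?e x] k y x by (simp add: mult.commute)
      finally show "nm (y * x - x * y) \<le> 2 * nm x * ?d n" .
      show "(\<lambda>n. 2 * nm x * ?d n) \<longlonglongrightarrow> 0" using tendsto_mult_right_zero[OF y(3)] .
    qed (use y x in simp)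
    then show ?thesis by simp
  qed
  ultimately show thesis using that[of y] y by auto
qed

section \<open>Real and imaginary parts\<close>

lemma cartesian_star_mult:
  assumes "r \<in> B" "s \<in> B" "st r = r" "st s = s"
  shows "st (r + sc \<i> * s) = r - sc \<i> * s"
    and "st (r + sc \<i> * s) * (r + sc \<i> * s) = r * r + s * s + sc \<i> * (r * s - s * r)"
    and "(r + sc \<i> * s) * st (r + sc \<i> * s) = r * r + s * s - sc \<i> * (r * s - s * r)"
proof -
  have "s * sc (- \<i>) = - (sc \<i> * s)" using sc_comm[of s "- \<i>"] assms by (simp add: sc_minus)
  then show st: "st (r + sc \<i> * s) = r - sc \<i> * s"
    using assms by (simp add: st_add st_mult)
  have a: "r * (sc \<i> * s) = sc \<i> * (r * s)"
    using sc_comm[of r \<i>] assms by (simp flip: mult.assoc)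
  have b: "sc \<i> * s * (sc \<i> * s) = - (s * s)"
  proof -
    have "sc \<i> * s * (sc \<i> * s) = sc \<i> * (s * sc \<i>) * s" by (simp add: mult.assoc)
    also have "\<dots> = sc (\<i> * \<i>) * (s * s)" by (simp only: sc_comm[OF assms(2)] sc_mult mult.assoc)
    finally show ?thesis by (simp add: sc_minus)
  qed
  show "st (r + sc \<i> * s) * (r + sc \<i> * s) = r * r + s * s + sc \<i> * (r * s - s * r)"
    unfolding st using a b by (simp add: algebra_simps)
  show "(r + sc \<i> * s) * st (r + sc \<i> * s) = r * r + s * s - sc \<i> * (r * s - s * r)"
    unfolding st using a b by (simp add: algebra_simps)
qed

lemma cartesian_decomposition:
  assumes "z \<in> B"
  obtains a b where "a \<in> B" "b \<in> B" "st a = a" "st b = b" "z = a + sc \<i> * b"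
proof
  let ?a = "sc (1/2) * (z + st z)" and ?b = "sc (- \<i> / 2) * (z - st z)"
  show "?a \<in> B" "?b \<in> B" using assms by auto
  show "st ?a = ?a" using assms sc_comm[of "z + st z" "1/2"] by (simp add: st_add st_mult add.commute)
  have "st ?b = (st z - z) * sc (\<i> / 2)" using assms by (simp add: st_diff st_mult)
  also have "\<dots> = sc (\<i> / 2) * (st z - z)" using assms by (intro sc_comm) auto
  also have "\<dots> = ?b" using sc_minus[of "\<i> / 2"] by (simp add: algebra_simps)
  finally show "st ?b = ?b" .
  have "sc \<i> * ?b = sc (1/2) * (z - st z)" by (simp add: sc_collapse)
  moreover have "sc (1/2) * (z + st z) + sc (1/2) * (z - st z) = sc (1/2) * z + sc (1/2) * z"
    by (simp only: distrib_left right_diff_distrib) simp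
  ultimately show "z = ?a + sc \<i> * ?b" by simp
qed

text \<open>Since r and s commute, u = r + i s satisfies \<open>st u * u = 1\<close>, and r is the
  real part of u.\<close>

lemma nm_le_1_if_squares_sum_1:
  assumes rs: "r \<in> B" "s \<in> B" "st r = r" "st s = s" "r * s = s * r" "r * r + s * s = 1"
  shows "nm r \<le> 1"
proof -
  let ?u = "r + sc \<i> * s"
  have u: "?u \<in> B" using rs by simp
  have "st ?u * ?u = 1" using cartesian_star_mult(2)[of r s] rs by simp
  then have "(nm ?u)\<^sup>2 \<le> 1" using nm_star[OF u] nm_1 by simp
  then have 1: "nm ?u \<le> 1" using power2_le_imp_le[of "nm ?u" 1] by simp
  have "?u + st ?u = r + r" using cartesian_star_mult(1)[of r s] rs by simp
  then have "sc (1/2) * (?u + st ?u) = sc (1/2) * (r + r)" by (simp only:)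
  then have "r = sc (1/2) * (?u + st ?u)" by (simp only: distrib_left sc_half_double)
  also have "nm \<dots> \<le> 1" using nm_add[of ?u "st ?u"] nm_st[OF u] u 1 st_mem[OF u]
    by (simp add: nm_sc_mult)
  finally show ?thesis .
qed

text \<open>The root 1 - y of 1 - h^2 commutes with h, and the squares of the two add up to 1. Hence
  the root is a contraction, and so is its square.\<close>

lemma nm_one_minus_square:
  assumes h: "h \<in> B" "st h = h" "nm h \<le> 1"
  shows "nm (1 - h * h) \<le> 1"
proof -
  have "nm (h * h) \<le> 1 * 1" using h by (intro nm_mult_le) auto
  then obtain y where y: "y \<in> B" "st y = y" "(1 - y) * (1 - y) = 1 - h * h"
    "\<And>x. \<lbrakk>x \<in> B; h * h * x = x * (h * h)\<rbrakk> \<Longrightarrow> y * x = x * y"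
    using sqrt_one_minus[of "h * h"] h by (auto simp: st_mult)
  have "y * h = h * y" using y(4) h by (simp add: mult.assoc)
  then have "(1 - y) * h = h * (1 - y)" by (simp add: left_diff_distrib right_diff_distrib)
  then have "nm (1 - y) \<le> 1"
    by (rule nm_le_1_if_squares_sum_1[rotated 4]) (use h y in \<open>simp_all add: st_diff\<close>)
  then have "nm ((1 - y) * (1 - y)) \<le> 1 * 1" using y by (intro nm_mult_le) auto
  then show ?thesis unfolding y(3) by simp
qed

section \<open>The positive cone and square roots in it\<close>

text \<open>Equivalently, \<open>h\<close> is self-adjoint with nonnegative spectrum.\<close>

definition pos :: "'b \<Rightarrow> bool" where
  "pos h \<longleftrightarrow> h \<in> B \<and> st h = h \<and> (\<exists>t\<ge>0. nm (rs t - h) \<le> t)"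

lemma pos_mem: "pos h \<Longrightarrow> h \<in> B" and pos_st: "pos h \<Longrightarrow> st h = h"
  by (auto simp: pos_def)

lemma posI: "\<lbrakk>h \<in> B; st h = h; t \<ge> 0; nm (rs t - h) \<le> t\<rbrakk> \<Longrightarrow> pos h"
  by (auto simp: pos_def)

text \<open>Raising the witness by 1 keeps the estimate and makes it strictly positive, so that it
  can be divided by.\<close>

lemma posE:
  assumes "pos h"
  obtains t where "t > 0" "nm (rs t - h) \<le> t"
proof -
  from assms obtain t where t: "t \<ge> 0" "nm (rs t - h) \<le> t" and h: "h \<in> B" by (auto simp: pos_def)
  have eq: "rs (t + 1) - h = (rs t - h) + 1" by (simp add: sc_add)
  have "nm (rs (t + 1) - h) \<le> t + 1"
    unfolding eq using nm_add[of "rs t - h" 1] nm_1 t h by simp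
  with t that[of "t + 1"] show thesis by simp
qed

lemma pos_add:
  assumes "pos h" "pos k" shows "pos (h + k)"
proof -
  obtain t s where ts: "t > 0" "nm (rs t - h) \<le> t" "s > 0" "nm (rs s - k) \<le> s"
    using posE[OF assms(1)] posE[OF assms(2)] by metis
  have eq: "rs (t + s) - (h + k) = (rs t - h) + (rs s - k)" by (simp add: sc_add)
  have "nm (rs (t + s) - (h + k)) \<le> t + s"
    unfolding eq using nm_add[of "rs t - h" "rs s - k"] ts assms by (simp add: pos_mem)
  then show ?thesis using ts assms by (intro posI[of _ "t + s"]) (auto simp: st_add pos_mem pos_st)
qed

lemma pos_scale:
  assumes "pos h" "c \<ge> 0" shows "pos (rs c * h)"
proof -
  obtain t where t: "t > 0" "nm (rs t - h) \<le> t" using posE[OF assms(1)] by metis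
  have "rs (c * t) - rs c * h = rs c * (rs t - h)" by (simp add: sc_mult algebra_simps)
  then have "nm (rs (c * t) - rs c * h) \<le> c * t"
    using t assms by (simp add: nm_sc_mult pos_mem mult_left_mono)
  then show ?thesis using t assms
    by (intro posI[of _ "c * t"]) (auto simp: st_mult pos_mem pos_st sc_comm)
qed

lemma pos_rs: "c \<ge> 0 \<Longrightarrow> pos (rs c)"
  by (rule posI[of _ c]) auto

text \<open>After scaling h into the unit ball, \<open>nm_one_minus_square\<close> shows that t = 1
  is a witness.\<close>

lemma pos_square:
  assumes h: "h \<in> B" "st h = h" shows "pos (h * h)"
proof -
  define c where "c = nm h + 1"
  have c: "c > 0" using nm_nonneg[OF h(1)] by (simp add: c_def)
  define g where "g = rs (1 / c) * h"
  have g: "g \<in> B" "st g = g" using h by (auto simp: g_def st_mult sc_comm)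
  have "nm g \<le> 1" using h c by (simp add: g_def nm_sc_mult norm_divide) (simp add: c_def)
  then have "nm (1 - g * g) \<le> 1" using nm_one_minus_square g by blast
  then have "pos (g * g)" using g by (intro posI[of _ 1]) (auto simp: st_mult)
  then have "pos (rs (c * c) * (g * g))" using c by (intro pos_scale) auto
  moreover have "rs (c * c) * (g * g) = h * h"
  proof -
    have "g * g = rs (1 / c) * (h * rs (1 / c)) * h" by (simp only: g_def mult.assoc)
    also have "\<dots> = rs (1 / c) * (rs (1 / c) * (h * h))" by (simp only: sc_comm[OF h(1)] mult.assoc)
    finally show ?thesis using c by (simp only: of_real_mult sc_mult mult.assoc rs_mult_cancel)
  qed
  ultimately show ?thesis by simp
qed

text \<open>If t is a witness for h, then h = t (1 - k) with \<open>nm k \<le> 1\<close>. The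
  conclusion exposes the iterates and not only their limit, because \<open>pos_lm_sqrt\<close> has
  to track their form.\<close>

lemma pos_sqrt_iter:
  assumes "pos h"
  obtains t y where "t > 0" "y \<in> B" "st y = y" "nm y \<le> 1"
    "(\<lambda>n. nm (sqrt_iter (1 - rs (1 / t) * h) n - y)) \<longlonglongrightarrow> 0"
    "rs t * ((1 - y) * (1 - y)) = h" "\<And>x. \<lbrakk>x \<in> B; h * x = x * h\<rbrakk> \<Longrightarrow> y * x = x * y"
proof -
  obtain t where t: "t > 0" "nm (rs t - h) \<le> t" using posE[OF assms] by metis
  note h = pos_mem[OF assms] pos_st[OF assms]
  let ?k = "1 - rs (1 / t) * h"
  have k: "?k = rs (1 / t) * (rs t - h)"
    using t by (simp add: right_diff_distrib flip: sc_mult of_real_mult)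
  have "nm ?k \<le> 1" unfolding k using t h by (simp add: nm_sc_mult norm_divide)
  then obtain y where y: "y \<in> B" "st y = y" "nm y \<le> 1" "(\<lambda>n. nm (sqrt_iter ?k n - y)) \<longlonglongrightarrow> 0"
    "(1 - y) * (1 - y) = 1 - ?k" "\<And>x. \<lbrakk>x \<in> B; ?k * x = x * ?k\<rbrakk> \<Longrightarrow> y * x = x * y"
    using sqrt_one_minus[of ?k] h by (auto simp: st_diff st_mult sc_comm)
  have "y * x = x * y" if x: "x \<in> B" "h * x = x * h" for x
  proof (rule y(6)[OF x(1)])
    show "?k * x = x * ?k"
      using commute_mult[OF rs_comm[OF x(1)] x(2)]
      by (simp only: left_diff_distrib right_diff_distrib mult_1_left mult_1_right)
  qed
  moreover have "rs t * ((1 - y) * (1 - y)) = h" unfolding y(5) using rs_mult_cancel[of t h] t by simp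
  ultimately show thesis using that[of t y] t y by auto
qed

lemma pos_sqrt:
  assumes "pos h"
  obtains r where "pos r" "r * r = h" "\<And>x. \<lbrakk>x \<in> B; h * x = x * h\<rbrakk> \<Longrightarrow> r * x = x * r"
proof -
  obtain t y where y: "t > 0" "y \<in> B" "st y = y" "nm y \<le> 1"
    "rs t * ((1 - y) * (1 - y)) = h" "\<And>x. \<lbrakk>x \<in> B; h * x = x * h\<rbrakk> \<Longrightarrow> y * x = x * y"
    using pos_sqrt_iter[OF assms] by metis
  have "pos (1 - y)" using y by (intro posI[of _ 1]) (auto simp: st_diff)
  then have "pos (rs (sqrt t) * (1 - y))" using y by (intro pos_scale) auto
  moreover have "rs (sqrt t) * (1 - y) * (rs (sqrt t) * (1 - y)) = h"
  proof -
    have "rs (sqrt t) * (1 - y) * (rs (sqrt t) * (1 - y)) = rs (sqrt t) * ((1 - y) * rs (sqrt t)) * (1 - y)"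
      by (simp only: mult.assoc)
    also have "\<dots> = rs (sqrt t) * rs (sqrt t) * ((1 - y) * (1 - y))"
      using sc_comm[of "1 - y" "sqrt t"] y by (simp add: mult.assoc)
    also have "\<dots> = h" using y by (simp flip: sc_mult of_real_mult)
    finally show ?thesis .
  qed
  moreover have "rs (sqrt t) * (1 - y) * x = x * (rs (sqrt t) * (1 - y))" if "x \<in> B" "h * x = x * h" for x
    using y(6)[OF that] rs_comm[OF that(1)]
    by (intro commute_mult) (simp_all add: left_diff_distrib right_diff_distrib)
  ultimately show thesis using that by blast
qed

section \<open>Elements of the form x^* x are positive\<close>

lemma square_plus_pos_eq_0D:
  assumes h: "h \<in> B" "st h = h" and k: "pos k" and "h * h + k = 0"
  shows "h = 0"
proof -
  obtain r where r: "pos r" "r * r = k" "\<And>x. \<lbrakk>x \<in> B; k * x = x * k\<rbrakk> \<Longrightarrow> r * x = x * r"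
    using pos_sqrt[OF k] by metis
  have keq: "k = - (h * h)" using assms(4) by (simp add: eq_neg_iff_add_eq_0 add.commute)
  have rh: "r * h = h * r" using r(3)[of h] h by (simp add: keq mult.assoc)
  \<comment> \<open>As k = - h^2 commutes with h, so does its root r. Hence the cross terms cancel
    and \<open>st ?N * ?N = h * h + k = 0\<close>, so ?N and its real part h vanish.\<close>
  let ?N = "h + sc \<i> * r"
  have N: "?N \<in> B" using h r by (simp add: pos_mem)
  have "st ?N * ?N = 0"
    using cartesian_star_mult(2)[of h r] h r rh assms(4) by (simp add: pos_mem pos_st)
  then have "?N = 0" using star_mult_self_eq_0D N by blast
  moreover have "?N + st ?N = h + h"
    using cartesian_star_mult(1)[of h r] h r by (simp add: pos_mem pos_st)
  ultimately have "h + h = 0" by simp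
  then show ?thesis using sc_half_double[of h] by (simp flip: distrib_left)
qed

text \<open>For z = y s = a + i b, the commutators cancel in
  \<open>st z * z + z * st z = 2 (a^2 + b^2)\<close>. The hypothesis makes the left side minus a sum
  of the squares of s^2 and of \<open>y * st y\<close>. A sum of squares is then zero, which forces
  s^2 = 0.\<close>

lemma star_mult_self_neg_square:
  assumes y: "y \<in> B" and s: "s \<in> B" "st s = s" and eq: "st y * y = - (s * s)"
  shows "st y * y = 0"
proof -
  let ?z = "y * s" and ?m = "y * st y"
  have z: "?z \<in> B" and m: "?m \<in> B" "st ?m = ?m" using y s by (auto simp: st_mult)
  obtain a b where ab: "a \<in> B" "b \<in> B" "st a = a" "st b = b" "?z = a + sc \<i> * b"
    using cartesian_decomposition[OF z] by metis
  have "st ?z * ?z + ?z * st ?z = (a * a + b * b) + (a * a + b * b)"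
    unfolding ab(5) using cartesian_star_mult(2,3)[OF ab(1-4)] by simp
  moreover have "st ?z * ?z = - (s * s * (s * s))"
  proof -
    have "st ?z * ?z = s * (st y * y) * s" using y s by (simp add: st_mult mult.assoc)
    then show ?thesis by (simp add: eq mult.assoc)
  qed
  moreover have "?z * st ?z = - (?m * ?m)"
  proof -
    have "?z * st ?z = y * (s * s) * st y" using y s by (simp add: st_mult mult.assoc)
    also have "s * s = - (st y * y)" by (simp add: eq)
    finally show ?thesis by (simp add: mult.assoc)
  qed
  \<comment> \<open>The rearrangement is proved for abstract summands, to keep the products from
    being expanded.\<close>
  moreover have "P + (Q + S) = 0" if "U + V = S" "U = - P" "V = - Q" for P Q S U V :: 'b
    using that by auto
  ultimately have "s * s * (s * s) + (?m * ?m + ((a * a + b * b) + (a * a + b * b))) = 0"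
    by metis
  moreover have "pos (?m * ?m + ((a * a + b * b) + (a * a + b * b)))"
    using ab m by (intro pos_add pos_square)
  ultimately have "s * s = 0"
    using s by (intro square_plus_pos_eq_0D[of "s * s"]) (auto simp: st_mult)
  then show ?thesis using eq by simp
qed

text \<open>With \<open>h = st x * x\<close>, \<open>a = \<bar>h\<bar>\<close> and \<open>w = a - h\<close> one has \<open>w h = - a w\<close>, so that
  \<open>x w\<close> satisfies the previous lemma.\<close>

lemma pos_star_mult_self:
  assumes x: "x \<in> B" shows "pos (st x * x)"
proof -
  let ?h = "st x * x"
  have h: "?h \<in> B" "st ?h = ?h" using x by (auto simp: st_mult)
  obtain a where a: "pos a" "a * a = ?h * ?h" "\<And>u. \<lbrakk>u \<in> B; ?h * ?h * u = u * (?h * ?h)\<rbrakk> \<Longrightarrow> a * u = u * a"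
    using pos_sqrt[OF pos_square[OF h]] by metis
  have ah: "a * ?h = ?h * a" by (rule a(3)[OF h(1)]) (simp add: mult.assoc)
  \<comment> \<open>With q the root of a, the element s = q w is self-adjoint and s^2 = a w^2, which
    is the shape that \<open>star_mult_self_neg_square\<close> requires.\<close>
  obtain q where q: "pos q" "q * q = a" "\<And>u. \<lbrakk>u \<in> B; a * u = u * a\<rbrakk> \<Longrightarrow> q * u = u * q"
    using pos_sqrt[OF a(1)] by metis
  let ?w = "a - ?h"
  have w: "?w \<in> B" "st ?w = ?w" using a(1) h by (auto simp: pos_mem pos_st st_diff)
  have aw: "a * ?w = ?w * a" using ah by (simp only: left_diff_distrib right_diff_distrib)
  have wh: "?w * ?h = - (a * ?w)"
    using ah a(2) by (simp only: left_diff_distrib right_diff_distrib) simp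
  have qw: "q * ?w = ?w * q" using q(3)[OF w(1) aw] .
  let ?s = "q * ?w"
  have s: "?s \<in> B" "st ?s = ?s" using q(1) w qw by (auto simp: pos_mem pos_st st_mult)
  have ss: "?s * ?s = a * ?w * ?w"
  proof -
    have "?s * ?s = q * (q * ?w) * ?w" using qw by (metis mult.assoc)
    then show ?thesis using q(2) by (metis mult.assoc)
  qed
  have y: "x * ?w \<in> B" using x w by simp
  have eq: "st (x * ?w) * (x * ?w) = - (?s * ?s)"
  proof -
    have "st (x * ?w) * (x * ?w) = ?w * ?h * ?w" using st_mult[OF x w(1)] w(2) by (simp add: mult.assoc)
    then show ?thesis using wh ss by simp
  qed
  then have "st (x * ?w) * (x * ?w) = 0" using star_mult_self_neg_square y s by blast
  then have "?s * ?s = 0" using eq by simp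
  then have "?s = 0" using square_eq_0D s by blast
  then have "a * ?w = 0" using q(2) by (metis mult.assoc mult_zero_right)
  then have "?w * ?h = 0" using wh by simp
  moreover have "?w * a = 0" using aw \<open>a * ?w = 0\<close> by simp
  \<comment> \<open>Both w h and w a vanish, hence so does w (a - h) = w^2; thus h equals its
    absolute value a.\<close>
  ultimately have "?w * ?w = 0" by (simp only: right_diff_distrib) simp
  then have "?w = 0" using square_eq_0D w by blast
  then show ?thesis using a(1) by simp
qed

section \<open>Uniform witnesses, closedness and inverses\<close>

lemma nm_diff_le_if_pos:
  assumes "pos h" "nm h \<le> t" shows "nm (rs t - h) \<le> t"
proof (cases "t = 0")
  case True
  then have "nm h = 0" using assms(2) nm_nonneg[OF pos_mem[OF assms(1)]] by linarith
  then have "h = 0" using pos_mem[OF assms(1)] nm_eq_0D by blast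
  then show ?thesis using True by simp
next
  case False
  then have t: "t > 0" using assms pos_mem[OF assms(1)] nm_nonneg[of h] by linarith
  \<comment> \<open>The root r of h / t is a contraction, so \<open>nm_one_minus_square\<close>
    bounds 1 - h / t. Hence every t \<ge> \<open>nm h\<close> is a witness.\<close>
  obtain r where r: "pos r" "r * r = rs (1 / t) * h"
    using pos_sqrt[OF pos_scale[OF assms(1), of "1 / t"]] t by auto
  have "(nm r)\<^sup>2 = nm (r * r)" using nm_star[of r] r(1) by (simp add: pos_mem pos_st)
  also have "\<dots> \<le> 1" using r(2) t assms by (simp add: nm_sc_mult pos_mem norm_divide)
  finally have "nm r \<le> 1" using power2_le_imp_le[of "nm r" 1] by simp
  then have 1: "nm (1 - rs (1 / t) * h) \<le> 1"
    using nm_one_minus_square[of r] r by (simp add: pos_mem pos_st)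
  have "rs t - h = rs t * (1 - rs (1 / t) * h)" using rs_mult_cancel[of t h] t by (simp add: right_diff_distrib)
  then show ?thesis using 1 t assms by (simp add: nm_sc_mult pos_mem)
qed

text \<open>By \<open>nm_diff_le_if_pos\<close>, the single witness \<open>nm h + 1\<close> serves
  all shifts by at most 1; letting the shift tend to 0 leaves it a witness for h.\<close>

lemma pos_if_pos_shift:
  assumes h: "h \<in> B" "st h = h" and pos: "\<And>e. e > 0 \<Longrightarrow> pos (rs e + h)"
  shows "pos h"
proof (rule posI[OF h, of "nm h + 1"])
  let ?t = "nm h + 1"
  show "?t \<ge> 0" using h nm_nonneg[of h] by linarith
  have "nm (rs ?t - h) \<le> ?t + e" if "e > 0" for e
  proof -
    define d where "d = min e 1"
    have d: "d > 0" "d \<le> 1" "d \<le> e" using that by (auto simp: d_def)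
    have n: "nm (rs d) \<le> d" using nm_sc[of d] d by simp
    then have "nm (rs d + h) \<le> ?t" using nm_add[of "rs d" h] h d by simp
    then have 1: "nm (rs ?t - (rs d + h)) \<le> ?t" by (intro nm_diff_le_if_pos pos d)
    have "rs ?t - h = (rs ?t - (rs d + h)) + rs d" by simp
    also have "nm \<dots> \<le> nm (rs ?t - (rs d + h)) + nm (rs d)" using h by (intro nm_add) auto
    finally show ?thesis using 1 n d by linarith
  qed
  then show "nm (rs ?t - h) \<le> ?t" by (rule field_le_epsilon)
qed

text \<open>The partial sums of the geometric series in k are dominated by those in q and converge
  to the inverse.\<close>

lemma neumann_inverse:
  assumes k: "k \<in> B" "nm k \<le> q" "q < 1"
  obtains z where "z \<in> B" "(1 - k) * z = 1" "z * (1 - k) = 1"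
proof -
  define f where "f n = (\<Sum>i<n. k ^ i)" for n
  have kB: "k ^ i \<in> B" for i using k by (induction i) auto
  have fB: "f n \<in> B" for n unfolding f_def using kB by (induction n) auto
  have q0: "q \<ge> 0" using k nm_nonneg[of k] by linarith
  have kn: "nm (k ^ i) \<le> q ^ i" for i
    by (induction i) (use nm_1 k kB nm_mult_le in auto)
  have "(\<lambda>n. \<Sum>i<n. q ^ i) \<longlonglongrightarrow> 1 / (1 - q)"
    using geometric_sums[of q] k q0 by (simp add: sums_def)
  then obtain z where z: "z \<in> B" "(\<lambda>n. nm (f n - z)) \<longlonglongrightarrow> 0"
    using convergent_if_dominated[of f "\<lambda>n. \<Sum>i<n. q ^ i"] fB kn by (auto simp: f_def)
  have g: "(\<lambda>n. nm (1 - k) * nm (f n - z) + q ^ n) \<longlonglongrightarrow> 0"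
    using tendsto_add[OF tendsto_mult_right_zero[OF z(2)] LIMSEQ_power_zero[of q]] k q0 by simp
  have f1: "(1 - k) * f n = 1 - k ^ n" for n
  proof (induction n)
    case (Suc n)
    have "(1 - k) * f (Suc n) = (1 - k) * f n + (1 - k) * k ^ n"
      by (simp add: f_def distrib_left)
    then show ?case unfolding Suc by (simp add: left_diff_distrib)
  qed (simp add: f_def)
  have f2: "f n * (1 - k) = 1 - k ^ n" for n
  proof (induction n)
    case (Suc n)
    have "f (Suc n) * (1 - k) = f n * (1 - k) + k ^ n * (1 - k)"
      by (simp add: f_def distrib_right)
    then show ?case unfolding Suc by (simp add: right_diff_distrib power_commutes)
  qed (simp add: f_def)
  have "(1 - k) * z - 1 = 0"
  proof (rule nm_le_imp_eq_0[OF _ _ g])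
    fix n
    have "(1 - k) * z - 1 = - ((1 - k) * (f n - z) + k ^ n)"
      using f1[of n] by (simp add: right_diff_distrib)
    also have "nm \<dots> \<le> nm ((1 - k) * (f n - z)) + nm (k ^ n)"
      using k fB kB z by (subst nm_minus) (auto intro: nm_add)
    also have "\<dots> \<le> nm (1 - k) * nm (f n - z) + q ^ n"
      using nm_mult[of "1 - k" "f n - z"] k fB z kn[of n] by simp
    finally show "nm ((1 - k) * z - 1) \<le> nm (1 - k) * nm (f n - z) + q ^ n" .
  qed (use k z in simp)
  moreover have "z * (1 - k) - 1 = 0"
  proof (rule nm_le_imp_eq_0[OF _ _ g])
    fix n
    have "z * (1 - k) - 1 = - ((f n - z) * (1 - k) + k ^ n)"
      using f2[of n] by (simp add: left_diff_distrib)
    also have "nm \<dots> \<le> nm ((f n - z) * (1 - k)) + nm (k ^ n)"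
      using k fB kB z by (subst nm_minus) (auto intro: nm_add)
    also have "\<dots> \<le> nm (1 - k) * nm (f n - z) + q ^ n"
      using nm_mult[of "f n - z" "1 - k"] k fB z kn[of n] by (simp add: mult.commute)
    finally show "nm (z * (1 - k) - 1) \<le> nm (1 - k) * nm (f n - z) + q ^ n" .
  qed (use k z in simp)
  ultimately show thesis using that[of z] z by simp
qed

text \<open>Write e + g = (t + e) (1 - k) with k = (t - g) / (t + e). A witness t for g gives
  \<open>nm k \<le> t / (t + e) < 1\<close>, so the Neumann series applies.\<close>

lemma pos_shift_inverse:
  assumes g: "pos g" and e: "e > 0"
  obtains z where "z \<in> B" "st z = z" "z * (rs e + g) = 1" "(rs e + g) * z = 1"
    "\<And>x. \<lbrakk>x \<in> B; g * x = x * g\<rbrakk> \<Longrightarrow> z * x = x * z"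
proof -
  obtain t where t: "t > 0" "nm (rs t - g) \<le> t" using posE[OF g] by metis
  let ?c = "1 / (t + e)" and ?G = "rs e + g"
  let ?k = "rs ?c * (rs t - g)"
  have gB: "g \<in> B" "st g = g" using g by (auto simp: pos_mem pos_st)
  have GB: "?G \<in> B" "st ?G = ?G" using gB by (auto simp: st_add)
  have "nm ?k = ?c * nm (rs t - g)" using gB t e
    by (subst nm_sc_mult) (auto simp flip: of_real_divide of_real_add simp del: of_real_divide of_real_add)
  also have "\<dots> \<le> ?c * t" using t e by (intro mult_left_mono) auto
  finally have k: "nm ?k \<le> ?c * t" .
  have "?c * t < 1" using t e by simp
  then obtain z where z: "z \<in> B" "(1 - ?k) * z = 1" "z * (1 - ?k) = 1"
    using neumann_inverse[OF _ k] gB by auto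
  have one: "rs ?c * rs (t + e) = 1"
    using t e by (simp flip: sc_mult of_real_mult of_real_divide of_real_add)
  have "1 - ?k = rs ?c * rs (t + e) - ?k" by (simp only: one)
  also have "\<dots> = rs ?c * ?G" by (simp add: sc_add algebra_simps)
  finally have eq: "1 - ?k = rs ?c * ?G" .
  let ?z = "rs ?c * z"
  have zB: "?z \<in> B" using z by simp
  have zG: "?z * ?G = 1"
  proof -
    have "?z * ?G = z * (rs ?c * ?G)" using rs_comm[OF z(1), of ?c] by (simp add: mult.assoc)
    then show ?thesis using z(3) eq by simp
  qed
  have Gz: "?G * ?z = 1"
  proof -
    have "?G * ?z = rs ?c * ?G * z" using rs_comm[OF GB(1), of ?c] by (simp add: mult.assoc)
    then show ?thesis using z(2) eq by simp
  qed
  have "st ?z = ?z"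
  proof -
    have "st ?z * ?G = 1" using arg_cong[OF Gz, of st] GB zB st_mult[OF GB(1) zB] by simp
    then have "st ?z * (?G * ?z) = ?z" by (simp flip: mult.assoc)
    then show ?thesis using Gz by simp
  qed
  moreover have "?z * x = x * ?z" if x: "x \<in> B" "g * x = x * g" for x
  proof -
    have Gx: "?G * x = x * ?G" using x rs_comm[OF x(1), of e] by (simp add: distrib_left distrib_right)
    have "?z * x = ?z * x * (?G * ?z)" using Gz by simp
    also have "\<dots> = ?z * (x * ?G) * ?z" by (simp only: mult.assoc)
    also have "\<dots> = ?z * ?G * x * ?z" using Gx by (simp only: mult.assoc)
    finally show ?thesis using zG by simp
  qed
  ultimately show thesis using that[OF zB _ zG Gz] by blast
qed

section \<open>From norm domination to order\<close>

text \<open>Testing the norm inequality on \<open>T = (g + e)\<^sup>-\<^sup>1\<^sup>/\<^sup>2\<close> turns it into an order inequality.\<close>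

lemma pos_diff_if_norm_dominated:
  assumes g: "pos g" and d: "pos d" and M: "M > 0"
    and dom: "\<And>T. T \<in> B \<Longrightarrow> nm (st T * (d * T)) \<le> M * nm (st T * (g * T))"
  shows "pos (rs M * g - d)"
proof (rule pos_if_pos_shift)
  show "rs M * g - d \<in> B" "st (rs M * g - d) = rs M * g - d"
    using g d by (auto simp: pos_mem pos_st st_diff st_mult sc_comm)
next
  fix e' :: real assume "e' > 0"
  \<comment> \<open>With this choice M (g + e) - d = e' + (M g - d), the shift asked for by
    \<open>pos_if_pos_shift\<close>.\<close>
  define e where "e = e' / M"
  have e: "e > 0" "e' = M * e" using M \<open>e' > 0\<close> by (auto simp: e_def)
  have gB: "g \<in> B" "st g = g" and dB: "d \<in> B" "st d = d" using g d by (auto simp: pos_mem pos_st)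
  let ?G = "rs e + g"
  have G: "pos ?G" using g e by (intro pos_add pos_rs) auto
  obtain z where z: "z \<in> B" "st z = z" "z * ?G = 1" "?G * z = 1"
    "\<And>x. \<lbrakk>x \<in> B; g * x = x * g\<rbrakk> \<Longrightarrow> z * x = x * z"
    using pos_shift_inverse[OF g e(1)] by metis
  obtain R where R: "pos R" "R * R = ?G" "\<And>x. \<lbrakk>x \<in> B; ?G * x = x * ?G\<rbrakk> \<Longrightarrow> R * x = x * R"
    using pos_sqrt[OF G] by metis
  obtain u where u: "pos u" "u * u = g"
    using pos_sqrt[OF g] by metis
  have RB: "R \<in> B" "st R = R" and uB: "u \<in> B" "st u = u" using R u by (auto simp: pos_mem pos_st)
  have gu: "g * u = u * g" by (simp add: mult.assoc flip: u(2))
  have comm: "R * x = x * R" if "x \<in> B" "g * x = x * g" for x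
    using R(3)[OF that(1)] that(2) rs_comm[OF that(1)] by (simp add: distrib_left distrib_right)
  have Ru: "R * u = u * R" and Rg: "R * g = g * R" using comm[OF uB(1) gu] comm[OF gB(1)] by auto
  have zu: "z * u = u * z" using z(5)[OF uB(1) gu] .
  have zR: "z * R = R * z" using z(5)[OF RB(1)] Rg by simp
  \<comment> \<open>As R is the root of g + e and z is the inverse of g + e, a is the inverse of
    R.\<close>
  define a where "a = R * z"
  have aB: "a \<in> B" "st a = a" using RB z(1,2) zR by (auto simp: a_def st_mult)
  have Ra: "R * a = 1" using R(2) z(4) by (simp add: a_def flip: mult.assoc)
  have aR: "a * R = 1" using R(2) z(4) zR by (simp add: a_def mult.assoc) (simp flip: mult.assoc)
  have aa: "a * a = z"
  proof -
    have "a * a = R * a * z" using zR by (simp add: a_def mult.assoc) (simp flip: mult.assoc)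
    then show ?thesis using Ra by simp
  qed
  have au: "a * u = u * a" unfolding a_def using Ru zu by (rule commute_mult)
  \<comment> \<open>The square of b is e z and that of u a is g z, so they add up to 1. This makes u
    a a contraction and bounds a g a by 1.\<close>
  let ?b = "rs (sqrt e) * a"
  have b: "?b \<in> B" "st ?b = ?b" using aB by (auto simp: st_mult sc_comm)
  have bb: "?b * ?b = rs e * z"
  proof -
    have "?b * ?b = rs (sqrt e) * (a * rs (sqrt e)) * a" by (simp only: mult.assoc)
    also have "\<dots> = rs (sqrt e) * rs (sqrt e) * (a * a)" by (simp only: sc_comm[OF aB(1)] mult.assoc)
    finally show ?thesis using aa e by (simp flip: sc_mult of_real_mult)
  qed
  have uaua: "u * a * (u * a) = g * z"
  proof -
    have "u * a * (u * a) = u * (a * u) * a" by (simp only: mult.assoc)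
    also have "\<dots> = u * u * (a * a)" by (simp only: au mult.assoc)
    finally show ?thesis by (simp add: aa u(2))
  qed
  have uab: "u * a * ?b = ?b * (u * a)"
  proof -
    have "u * a * ?b = rs (sqrt e) * (u * a * a)"
      using rs_comm[of "u * a" "sqrt e"] uB aB by (simp flip: mult.assoc)
    also have "u * a * a = a * (u * a)" using au by (simp flip: mult.assoc)
    finally show ?thesis by (simp add: mult.assoc)
  qed
  have "nm (u * a) \<le> 1"
  proof (rule nm_le_1_if_squares_sum_1)
    show "u * a * (u * a) + ?b * ?b = 1" using z(4) by (simp add: uaua bb distrib_right add.commute)
  qed (use uB aB au b uab in \<open>auto simp: st_mult[of u a]\<close>)
  then have "nm (u * a * (u * a)) \<le> 1 * 1" using uB aB by (intro nm_mult_le) auto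
  moreover have "st a * (g * a) = u * a * (u * a)"
    unfolding aB(2) u(2)[symmetric] using arg_cong[OF au, of "\<lambda>x. x * (u * a)"] by (simp only: mult.assoc)
  ultimately have "nm (st a * (g * a)) \<le> 1" by simp
  then have "M * nm (st a * (g * a)) \<le> M * 1" using M by (intro mult_left_mono) auto
  with dom[OF aB(1)] have nad: "nm (a * (d * a)) \<le> M" unfolding aB(2) by simp
  let ?Z = "rs M - a * (d * a)"
  have ZB: "?Z \<in> B" "st ?Z = ?Z"
    using aB dB by (auto simp: st_diff st_mult mult.assoc)
  have "pos ?Z" using ZB M nad by (intro posI[of _ M]) auto
  then obtain q where q: "pos q" "q * q = ?Z" using pos_sqrt by metis
  have qR: "q * R \<in> B" using q RB by (simp add: pos_mem)
  \<comment> \<open>Conjugating M - a d a by R undoes the conjugation by a and gives M (g + e) - d,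
    now visibly of the form \<open>st x * x\<close>.\<close>
  have "st (q * R) * (q * R) = R * (q * q) * R"
    using st_mult[of q R] RB pos_mem[OF q(1)] pos_st[OF q(1)] by (simp only: mult.assoc)
  also have "\<dots> = R * rs M * R - (R * a) * d * (a * R)"
    unfolding q(2) by (simp add: left_diff_distrib right_diff_distrib mult.assoc)
  also have "R * rs M * R = rs M * ?G" using sc_comm[OF RB(1)] R(2) by (simp add: mult.assoc)
  also have "rs M * ?G - (R * a) * d * (a * R) = rs e' + (rs M * g - d)"
    using Ra aR by (simp add: e(2) sc_mult distrib_left)
  finally show "pos (rs e' + (rs M * g - d))" using pos_star_mult_self[OF qR] by simp
qed

end

section \<open>Bounded operators on a pro-C*-algebra\<close>

text \<open>Additive maps form a ring with unit under composition even when the algebra has no unit.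
  Additivity alone is built in; complex linearity will follow from having an adjoint.\<close>

typedef (overloaded) 'a endo = "{f :: 'a::ab_group_add \<Rightarrow> 'a. \<forall>x y. f (x + y) = f x + f y}"
  morphisms app Endo
  by (rule exI[of _ "\<lambda>x. x"]) simp

setup_lifting type_definition_endo

instantiation endo :: (ab_group_add) "{ring, monoid_mult}"
begin

lift_definition zero_endo :: "'a endo" is "\<lambda>x. 0" by simp
lift_definition one_endo :: "'a endo" is "\<lambda>x. x" by simp
lift_definition plus_endo :: "'a endo \<Rightarrow> 'a endo \<Rightarrow> 'a endo" is "\<lambda>f g x. f x + g x"
  by (simp add: algebra_simps)
lift_definition minus_endo :: "'a endo \<Rightarrow> 'a endo \<Rightarrow> 'a endo" is "\<lambda>f g x. f x - g x"
  by (simp add: algebra_simps)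
lift_definition uminus_endo :: "'a endo \<Rightarrow> 'a endo" is "\<lambda>f x. - f x"
  by (simp add: algebra_simps)
lift_definition times_endo :: "'a endo \<Rightarrow> 'a endo \<Rightarrow> 'a endo" is "\<lambda>f g x. f (g x)"
  by simp

instance
  by standard (transfer; simp add: fun_eq_iff algebra_simps)+

end

lemma app_add: "app f (x + y) = app f x + app f y"
  using app[of f] by simp

lemma app_0 [simp]: "app f 0 = 0"
  using app_add[of f 0 0] by simp

lemma app_minus: "app f (- x) = - app f x"
  using app_add[of f x "- x"] by (simp add: eq_neg_iff_add_eq_0 add.commute)

lemma app_diff: "app f (x - y) = app f x - app f y"
  using app_add[of f x "- y"] by (simp add: app_minus)

lemma app_simps [simp]:
  "app 0 x = 0" "app 1 x = x" "app (f + g) x = app f x + app g x" "app (f - g) x = app f x - app g x"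
  "app (- f) x = - app f x" "app (f * g) x = app f (app g x)"
  by (transfer; simp)+

lemma endo_eqI: "(\<And>x. app f x = app g x) \<Longrightarrow> f = g"
  by (simp add: app_inject[symmetric] fun_eq_iff)

section \<open>Seminorm calculus in a pro-C*-algebra\<close>

locale pro_cstar =
  fixes A :: "'a::ring pro_alg"
  assumes pro: "pro_C_star_algebra A"
begin

abbreviation sm where "sm \<equiv> smul A"
abbreviation iv where "iv \<equiv> invol A"
abbreviation N where "N \<equiv> sn A"

lemma sm_add: "sm c (x + y) = sm c x + sm c y"
  and sm_add_left: "sm (c + d) x = sm c x + sm d x"
  and sm_sm: "sm c (sm d x) = sm (c * d) x"
  and sm_1 [simp]: "sm 1 x = x"
  and sm_mult_left: "sm c x * y = sm c (x * y)"
  and sm_mult_right: "x * sm c y = sm c (x * y)"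
  and iv_add: "iv (x + y) = iv x + iv y"
  and iv_mult: "iv (x * y) = iv y * iv x"
  and iv_sm: "iv (sm c x) = sm (cnj c) (iv x)"
  and iv_iv [simp]: "iv (iv x) = x"
  using pro unfolding pro_C_star_algebra_def complex_vs_def by metis+

lemma sm_0 [simp]: "sm 0 x = 0" and sm_zero [simp]: "sm c 0 = 0" and iv_0 [simp]: "iv 0 = 0"
  using sm_add_left[of 0 0 x] sm_add[of c 0 0] iv_add[of 0 0] by auto

lemma sm_minus_left: "sm (- c) x = - sm c x" and sm_minus: "sm c (- x) = - sm c x"
  and iv_minus: "iv (- x) = - iv x"
  using sm_add_left[of c "- c" x] sm_add[of c x "- x"] iv_add[of x "- x"]
  by (auto simp: eq_neg_iff_add_eq_0 add.commute)

lemma sm_diff: "sm c (x - y) = sm c x - sm c y" and iv_diff: "iv (x - y) = iv x - iv y"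
  and sm_diff_left: "sm (c - d) x = sm c x - sm d x"
  using sm_add[of c x "- y"] iv_add[of x "- y"] sm_add_left[of c "- d" x]
  by (auto simp: sm_minus sm_minus_left iv_minus)

lemma sn_C_star: "p \<in> N \<Longrightarrow> C_star_seminorm A p"
  using pro by (auto simp: pro_C_star_algebra_def)

lemma p_nonneg: "p \<in> N \<Longrightarrow> 0 \<le> p x"
  and p_add: "p \<in> N \<Longrightarrow> p (x + y) \<le> p x + p y"
  and p_sm: "p \<in> N \<Longrightarrow> p (sm c x) = cmod c * p x"
  and p_mult: "p \<in> N \<Longrightarrow> p (x * y) \<le> p x * p y"
  and p_star: "p \<in> N \<Longrightarrow> p (iv x * x) = (p x)\<^sup>2"
  by (auto dest!: sn_C_star simp: C_star_seminorm_def)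

lemma p_0: "p \<in> N \<Longrightarrow> p 0 = 0"
  using p_sm[of p 0 0] by simp

lemma p_minus: "p \<in> N \<Longrightarrow> p (- x) = p x"
  using p_sm[of p "- 1" x] by (simp add: sm_minus_left)

lemma p_diff: "p \<in> N \<Longrightarrow> p (x - y) \<le> p x + p y"
  using p_add[of p x "- y"] by (simp add: p_minus)

lemma p_diff_commute: "p \<in> N \<Longrightarrow> p (x - y) = p (y - x)"
  using p_minus[of p "x - y"] by simp

lemma p_triangle: "p \<in> N \<Longrightarrow> p (x - z) \<le> p (x - y) + p (y - z)"
  using p_add[of p "x - y" "y - z"] by simp

lemma p_iv:
  assumes p: "p \<in> N" shows "p (iv x) = p x"
proof -
  have *: "p y \<le> p (iv y)" for y
  proof (cases "p y = 0")
    case False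
    then have "p y > 0" using p_nonneg[OF p, of y] by linarith
    moreover have "p y * p y \<le> p (iv y) * p y"
      using p_mult[OF p, of "iv y" y] p_star[OF p, of y] by (simp add: power2_eq_square)
    ultimately show ?thesis by simp
  qed (simp add: p_nonneg[OF p])
  from *[of x] *[of "iv x"] show ?thesis by simp
qed

lemma hausdorff: "(\<And>p. p \<in> N \<Longrightarrow> p x = 0) \<Longrightarrow> x = 0"
  using pro by (auto simp: pro_C_star_algebra_def)

lemma eq_if_sn_le: "(\<And>p e. \<lbrakk>p \<in> N; e > 0\<rbrakk> \<Longrightarrow> p (x - y) \<le> e) \<Longrightarrow> x = y"
  using hausdorff[of "x - y"] p_nonneg
  by (metis eq_iff_diff_eq_0 field_le_epsilon add_0 order_antisym)

lemma sn_complete: "sn_complete N"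
  using pro by (simp add: pro_C_star_algebra_def)

lemma sn_closed:
  assumes "C_star_seminorm A q" "finite F" "F \<subseteq> N" "\<And>x. q x \<le> c * (\<Sum>p\<in>F. p x)"
  shows "q \<in> N"
  using pro assms unfolding pro_C_star_algebra_def by blast

text \<open>The zero seminorm is dominated by the empty sum; it shows that the index set of the
  filter base in \<open>surj_if_bounded_below\<close> is nonempty.\<close>

lemma sn_zero: "(\<lambda>x. 0) \<in> N"
  by (rule sn_closed[of _ "{}" 0]) (auto simp: C_star_seminorm_def)

text \<open>This is directedness: the maximum is a C*-seminorm dominated by the sum, hence
  continuous, and all continuous C*-seminorms belong to \<open>sn A\<close>.\<close>

lemma sn_max:
  assumes p: "p \<in> N" and q: "q \<in> N"
  shows "(\<lambda>x. max (p x) (q x)) \<in> N"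
proof (rule sn_closed[of _ "{p, q}" 1])
  note pq = p_nonneg[OF p] p_nonneg[OF q]
  have add: "max (p (x + y)) (q (x + y)) \<le> max (p x) (q x) + max (p y) (q y)" for x y
    using p_add[OF p, of x y] p_add[OF q, of x y] by linarith
  have "p x * p y \<le> max (p x) (q x) * max (p y) (q y)" "q x * q y \<le> max (p x) (q x) * max (p y) (q y)" for x y
    using pq by (auto intro!: mult_mono simp: le_max_iff_disj)
  then have mult: "max (p (x * y)) (q (x * y)) \<le> max (p x) (q x) * max (p y) (q y)" for x y
    using p_mult[OF p, of x y] p_mult[OF q, of x y] by (meson max.bounded_iff order_trans)
  have star: "max (p (iv x * x)) (q (iv x * x)) = (max (p x) (q x))\<^sup>2" for x
  proof (cases "p x \<le> q x")
    case True
    then show ?thesis using pq[of x] by (simp add: p_star[OF p] p_star[OF q] max_absorb2 power_mono)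
  next
    case False
    then show ?thesis using pq[of x] by (simp add: p_star[OF p] p_star[OF q] max_absorb1 power_mono)
  qed
  show "C_star_seminorm A (\<lambda>x. max (p x) (q x))"
    unfolding C_star_seminorm_def using pq add mult star
    by (auto simp: p_sm[OF p] p_sm[OF q] le_max_iff_disj max_mult_distrib_left)
  show "max (p x) (q x) \<le> 1 * (\<Sum>p\<in>{p, q}. p x)" for x
    using pq[of x] by (cases "p = q") auto
qed (use p q in auto)

lemma seq_complete:
  fixes g :: "nat \<Rightarrow> 'a"
  assumes "\<And>p e. \<lbrakk>p \<in> N; e > 0\<rbrakk> \<Longrightarrow> \<exists>n0. \<forall>m\<ge>n0. \<forall>n\<ge>n0. p (g m - g n) < e"
  shows "\<exists>l. \<forall>p\<in>N. \<forall>e>0. eventually (\<lambda>n. p (g n - l) < e) sequentially"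
proof -
  let ?F = "filtermap g sequentially"
  have "sn_cauchy N ?F"
    unfolding sn_cauchy_def
  proof (intro ballI allI impI)
    fix p and e :: real assume "p \<in> N" "e > 0"
    then obtain n0 where n0: "\<And>m n. \<lbrakk>m \<ge> n0; n \<ge> n0\<rbrakk> \<Longrightarrow> p (g m - g n) < e" using assms by meson
    have "eventually (\<lambda>x. x \<in> g ` {n0..}) ?F"
      by (auto simp: eventually_filtermap eventually_sequentially)
    then show "\<forall>\<^sub>F (x, y) in ?F \<times>\<^sub>F ?F. p (x - y) < e"
      unfolding eventually_prod_filter using n0
      by (intro exI[of _ "\<lambda>x. x \<in> g ` {n0..}"]) auto
  qed
  moreover have "?F \<noteq> bot" by (simp add: filtermap_bot_iff)
  ultimately obtain l where "sn_converges N (\<lambda>x. x) l ?F"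
    using sn_complete unfolding sn_complete_def by blast
  then show ?thesis
    by (auto simp: sn_converges_def eventually_filtermap)
qed

text \<open>Approximate solutions for the individual seminorms are glued by completeness: they form a
  filter base because the seminorms are directed.\<close>

lemma surj_if_bounded_below:
  assumes low: "\<And>p z. p \<in> N \<Longrightarrow> p z \<le> p (app T z)"
    and up: "\<And>p. p \<in> N \<Longrightarrow> \<exists>c. \<forall>z. p (app T z) \<le> c * p z"
    and approx: "\<And>p e. \<lbrakk>p \<in> N; e > 0\<rbrakk> \<Longrightarrow> \<exists>z. p (x - app T z) < e"
  shows "\<exists>z. app T z = x"
proof -
  define S where "S = (\<lambda>(p, e). {z. p (x - app T z) < (e::real)})"
  define F where "F = (INF b\<in>N \<times> {0<..}. principal (S b))"
  have ev: "eventually P F \<longleftrightarrow> (\<exists>b\<in>N \<times> {0<..}. eventually P (principal (S b)))" for P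
    unfolding F_def
  proof (rule eventually_INF_base)
    show "N \<times> {0::real<..} \<noteq> {}" using sn_zero by auto
    fix a b assume "a \<in> N \<times> {0::real<..}" "b \<in> N \<times> {0::real<..}"
    then obtain p d q e where ab: "a = (p, d)" "b = (q, e)" "p \<in> N" "q \<in> N" "d > 0" "e > 0" by auto
    show "\<exists>c\<in>N \<times> {0<..}. principal (S c) \<le> inf (principal (S a)) (principal (S b))"
      by (rule bexI[of _ "(\<lambda>x. max (p x) (q x), min d e)"]) (use ab in \<open>auto simp: S_def sn_max\<close>)
  qed
  have evS: "eventually (\<lambda>z. p (x - app T z) < e) F" if "p \<in> N" "e > 0" for p e
    unfolding ev by (rule bexI[of _ "(p, e)"]) (use that in \<open>auto simp: S_def eventually_principal\<close>)
  have "F \<noteq> bot"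
  proof
    assume "F = bot"
    then have "eventually (\<lambda>z. False) F" by simp
    then obtain p e where "p \<in> N" "e > 0" "\<And>z. \<not> p (x - app T z) < e"
      unfolding ev by (auto simp: eventually_principal S_def)
    then show False using approx by blast
  qed
  moreover have "sn_cauchy N F"
    unfolding sn_cauchy_def
  proof (intro ballI allI impI)
    fix p and e :: real assume p: "p \<in> N" and e: "e > 0"
    \<comment> \<open>The lower bound for T turns closeness of the images T z and T z' to x into
      closeness of z and z'.\<close>
    have "p (z - z') < e" if "p (x - app T z) < e / 2" "p (x - app T z') < e / 2" for z z'
    proof -
      have "p (z - z') \<le> p (app T z - app T z')" using low[OF p, of "z - z'"] by (simp add: app_diff)
      also have "\<dots> \<le> p (x - app T z) + p (x - app T z')"
        using p_triangle[OF p, of "app T z" "app T z'" x] p_diff_commute[OF p, of x "app T z"] by simp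
      finally show ?thesis using that by simp
    qed
    moreover have "eventually (\<lambda>z. p (x - app T z) < e / 2) F" using e by (intro evS p) simp
    ultimately show "\<forall>\<^sub>F (y, z) in F \<times>\<^sub>F F. p (y - z) < e"
      unfolding eventually_prod_filter by (intro exI[of _ "\<lambda>z. p (x - app T z) < e / 2"]) auto
  qed
  ultimately obtain l where l: "sn_converges N (\<lambda>x. x) l F"
    using sn_complete by (auto simp: sn_complete_def)
  have "app T l = x"
  proof (rule eq_if_sn_le)
    fix p and e :: real assume p: "p \<in> N" and e: "e > 0"
    obtain c where c: "\<And>z. p (app T z) \<le> c * p z" using up[OF p] by blast
    define c' where "c' = \<bar>c\<bar> + 1"
    have c': "c' > 0" by (simp add: c'_def)
    have "eventually (\<lambda>z. p (z - l) < e / (2 * c')) F" using l p e c' by (simp add: sn_converges_def)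
    moreover have "eventually (\<lambda>z. p (x - app T z) < e / 2) F" using e by (intro evS p) simp
    ultimately have "eventually (\<lambda>z. p (z - l) < e / (2 * c') \<and> p (x - app T z) < e / 2) F"
      by (rule eventually_conj)
    then obtain z where z: "p (z - l) < e / (2 * c')" "p (x - app T z) < e / 2"
      using eventually_happens' \<open>F \<noteq> bot\<close> by blast
    have "p (app T z - app T l) \<le> c * p (z - l)" using c[of "z - l"] by (simp add: app_diff)
    also have "\<dots> \<le> c' * p (z - l)" using p_nonneg[OF p] by (intro mult_right_mono) (auto simp: c'_def)
    also have "\<dots> \<le> c' * (e / (2 * c'))" using z c' by (intro mult_left_mono) auto
    also have "\<dots> = e / 2" using c' by simp
    finally show "p (app T l - x) \<le> e"
      using p_triangle[OF p, of x "app T l" "app T z"] p_diff_commute[OF p, of x "app T l"] z by simp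
  qed
  then show ?thesis by blast
qed

section \<open>Adjointable endomorphisms and left multiplications\<close>

lemma eq_if_iv_mult_eq:
  assumes "\<And>y. iv y * a = iv y * b" shows "a = b"
proof -
  have "iv (a - b) * (a - b) = 0" using assms[of "a - b"] by (simp add: right_diff_distrib)
  then have "p (a - b) = 0" if "p \<in> N" for p using p_star[OF that, of "a - b"] p_0[OF that] by simp
  then show ?thesis using hausdorff[of "a - b"] by simp
qed

text \<open>The algebra is regarded as a right Hilbert module over itself with inner product
  \<open>iv x * y\<close>. A relation is used because an adjoint need not exist.\<close>

definition adj :: "'a endo \<Rightarrow> 'a endo \<Rightarrow> bool" where
  "adj T S \<longleftrightarrow> (\<forall>x y. iv (app T x) * y = iv x * app S y)"

lemma adjD: "adj T S \<Longrightarrow> iv (app T x) * y = iv x * app S y"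
  by (simp add: adj_def)

lemma adj_unique:
  assumes "adj T S" "adj T S'" shows "S = S'"
  by (rule endo_eqI, rule eq_if_iv_mult_eq)
    (simp only: adjD[OF assms(1), symmetric] adjD[OF assms(2), symmetric])

lemma adj_sym:
  assumes "adj T S" shows "adj S T"
  unfolding adj_def
proof (intro allI)
  fix x y
  have "iv (app S x) * y = iv (iv y * app S x)" by (simp add: iv_mult)
  also have "\<dots> = iv (iv (app T y) * x)" by (simp only: adjD[OF assms])
  finally show "iv (app S x) * y = iv x * app T y" by (simp add: iv_mult)
qed

lemma adj_mult: "\<lbrakk>adj T S; adj T' S'\<rbrakk> \<Longrightarrow> adj (T * T') (S' * S)"
  by (simp add: adj_def)

lemma adj_add: "\<lbrakk>adj T S; adj T' S'\<rbrakk> \<Longrightarrow> adj (T + T') (S + S')"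
  by (simp add: adj_def iv_add distrib_left distrib_right)

lemma adj_diff: "\<lbrakk>adj T S; adj T' S'\<rbrakk> \<Longrightarrow> adj (T - T') (S - S')"
  by (simp add: adj_def iv_diff left_diff_distrib right_diff_distrib)

lemma adj_1: "adj 1 1"
  by (simp add: adj_def)

definition lm :: "'a \<Rightarrow> 'a endo" where "lm a = Endo (\<lambda>x. a * x)"

lemma app_lm [simp]: "app (lm a) x = a * x"
  unfolding lm_def by (subst Endo_inverse) (simp_all add: distrib_left)

definition scop :: "complex \<Rightarrow> 'a endo" where "scop c = Endo (sm c)"

lemma app_scop [simp]: "app (scop c) x = sm c x"
  unfolding scop_def by (subst Endo_inverse) (simp_all add: sm_add)

lemma adj_lm: "adj (lm a) (lm (iv a))"
  by (simp add: adj_def iv_mult mult.assoc)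

lemma adj_scop: "adj (scop c) (scop (cnj c))"
  by (simp add: adj_def iv_sm sm_mult_left sm_mult_right)

lemma lm_add: "lm (a + b) = lm a + lm b" and lm_diff: "lm (a - b) = lm a - lm b"
  and lm_mult: "lm (a * b) = lm a * lm b" and lm_sm: "lm (sm c a) = scop c * lm a"
  and lm_0: "lm 0 = 0"
  by (intro endo_eqI; simp add: distrib_right left_diff_distrib mult.assoc sm_mult_left)+

text \<open>The embedding into endomorphisms is faithful, so identities in the algebra can be
  checked on operators and pulled back.\<close>

lemma lm_inject: "lm a = lm b \<longleftrightarrow> a = b"
proof
  assume "lm a = lm b"
  then have "app (lm a) x = app (lm b) x" for x by simp
  then have "iv (a * x) = iv (b * x)" for x by simp
  then have "iv x * iv a = iv x * iv b" for x by (simp add: iv_mult)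
  then have "iv a = iv b" by (rule eq_if_iv_mult_eq)
  then have "iv (iv a) = iv (iv b)" by (simp only:)
  then show "a = b" by simp
qed simp

text \<open>An adjoint forces homogeneity, since scalars can be moved through the inner
  product.\<close>

lemma adj_app_sm:
  assumes "adj T S" shows "app T (sm c x) = sm c (app T x)"
  by (rule eq_if_iv_mult_eq) (simp only: adjD[OF adj_sym[OF assms], symmetric] sm_mult_right)

text \<open>Left multiplications form a right ideal among adjointable maps:
  \<open>b * app T x = iv (app S (iv b)) * x\<close>. Through this, products with resolvents return
  to the algebra.\<close>

lemma lm_mult_adj: "adj T S \<Longrightarrow> lm b * T = lm (iv (app S (iv b)))"
  by (intro endo_eqI) (simp add: adjD[OF adj_sym])

lemma lm_star_conj:
  assumes "adj T S" "lm b' = lm b * T"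
  shows "lm (iv b' * b') = S * lm (iv b * b) * T"
proof -
  have "lm (iv b') = S * lm (iv b)"
    using adj_unique[OF adj_lm[of b']] adj_mult[OF adj_lm[of b] assms(1)] assms(2) by simp
  then show ?thesis by (simp add: lm_mult assms(2) mult.assoc)
qed

section \<open>Uniform bounds and the operator norm\<close>

definition bnd :: "real \<Rightarrow> 'a endo \<Rightarrow> bool" where
  "bnd c T \<longleftrightarrow> 0 \<le> c \<and> (\<forall>p\<in>N. \<forall>x. p (app T x) \<le> c * p x)"

definition bops :: "'a endo set" where
  "bops = {T. (\<exists>c. bnd c T) \<and> (\<exists>S. adj T S)}"

definition star :: "'a endo \<Rightarrow> 'a endo" where
  "star T = (SOME S. adj T S)"

text \<open>As the constants in \<open>bnd\<close> serve all seminorms at once, a single norm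
  arises, and the operators form a C*-algebra.\<close>

definition opn :: "'a endo \<Rightarrow> real" where
  "opn T = Inf {c. bnd c T}"

lemma bndD: "\<lbrakk>bnd c T; p \<in> N\<rbrakk> \<Longrightarrow> p (app T x) \<le> c * p x"
  by (simp add: bnd_def)

lemma bnd_nonneg: "bnd c T \<Longrightarrow> 0 \<le> c"
  by (simp add: bnd_def)

lemma star_eq: "adj T S \<Longrightarrow> star T = S"
  unfolding star_def by (metis adj_unique someI)

lemma adj_star: "T \<in> bops \<Longrightarrow> adj T (star T)"
  by (auto simp: bops_def star_eq)

lemma opn_le: "bnd c T \<Longrightarrow> opn T \<le> c"
  unfolding opn_def by (rule cInf_lower) (auto simp: bnd_def bdd_below_def)

lemma bnd_opn:
  assumes "T \<in> bops" shows "bnd (opn T) T"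
proof -
  have ne: "{c. bnd c T} \<noteq> {}" using assms by (auto simp: bops_def)
  have "0 \<le> opn T" unfolding opn_def by (rule cInf_greatest[OF ne]) (simp add: bnd_def)
  moreover have "p (app T x) \<le> opn T * p x" if p: "p \<in> N" for p x
  proof (cases "p x = 0")
    case True
    then show ?thesis using ne bndD[OF _ p, of _ T x] by auto
  next
    case False
    then have px: "p x > 0" using p_nonneg[OF p, of x] by linarith
    have "p (app T x) / p x \<le> opn T" unfolding opn_def
      by (rule cInf_greatest[OF ne]) (use bndD[OF _ p, of _ T x] px in \<open>simp add: divide_le_eq\<close>)
    then show ?thesis using px by (simp add: divide_le_eq)
  qed
  ultimately show ?thesis by (simp add: bnd_def)
qed

lemma bnd_add:
  assumes T: "bnd c T" and S: "bnd d S" shows "bnd (c + d) (T + S)"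
  unfolding bnd_def
proof (intro conjI ballI allI)
  show "0 \<le> c + d" using T S by (simp add: bnd_def)
  fix p x assume p: "p \<in> N"
  show "p (app (T + S) x) \<le> (c + d) * p x"
    using p_add[OF p, of "app T x" "app S x"] bndD[OF T p, of x] bndD[OF S p, of x]
    by (simp add: distrib_right)
qed

lemma bnd_diff:
  assumes T: "bnd c T" and S: "bnd d S" shows "bnd (c + d) (T - S)"
  unfolding bnd_def
proof (intro conjI ballI allI)
  show "0 \<le> c + d" using T S by (simp add: bnd_def)
  fix p x assume p: "p \<in> N"
  show "p (app (T - S) x) \<le> (c + d) * p x"
    using p_diff[OF p, of "app T x" "app S x"] bndD[OF T p, of x] bndD[OF S p, of x]
    by (simp add: distrib_right)
qed

lemma bnd_mult:
  assumes T: "bnd c T" and S: "bnd d S" shows "bnd (c * d) (T * S)"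
  unfolding bnd_def
proof (intro conjI ballI allI)
  have c: "0 \<le> c" using T by (simp add: bnd_def)
  then show "0 \<le> c * d" using S by (simp add: bnd_def)
  fix p x assume p: "p \<in> N"
  show "p (app (T * S) x) \<le> c * d * p x"
    using bndD[OF T p, of "app S x"] mult_left_mono[OF bndD[OF S p, of x] c]
    by (simp add: mult.assoc)
qed

lemma bnd_1: "bnd 1 1"
  by (simp add: bnd_def)

lemma bnd_scop: "bnd (cmod c) (scop c)"
  by (simp add: bnd_def p_sm)

text \<open>Apply the C*-identity to S y, move S across as T, and cancel one factor
  \<open>p (app S y)\<close>.\<close>

lemma bnd_adj:
  assumes T: "bnd c T" and adj: "adj T S" shows "bnd c S"
  unfolding bnd_def
proof (intro conjI ballI allI)
  show "0 \<le> c" using T by (simp add: bnd_def)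
  fix p y assume p: "p \<in> N"
  have "p (app S y) * p (app S y) = p (iv y * app T (app S y))"
    using p_star[OF p, of "app S y"] adjD[OF adj_sym[OF adj], of y "app S y"] by (simp add: power2_eq_square)
  also have "\<dots> \<le> p y * p (app T (app S y))" using p_mult[OF p, of "iv y"] by (simp add: p_iv[OF p])
  also have "\<dots> \<le> p y * (c * p (app S y))" using bndD[OF T p] p_nonneg[OF p] by (intro mult_left_mono)
  finally have *: "p (app S y) * p (app S y) \<le> c * p y * p (app S y)" by (simp add: mult_ac)
  show "p (app S y) \<le> c * p y"
  proof (cases "p (app S y) = 0")
    case True
    then show ?thesis using p_nonneg[OF p] \<open>0 \<le> c\<close> by simp
  next
    case False
    then show ?thesis using * p_nonneg[OF p, of "app S y"] by (simp add: order_less_le)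
  qed
qed

text \<open>The square of \<open>p (app T x)\<close> is \<open>p (iv x * app S (app T x))\<close>,
  at most c times the square of \<open>p x\<close>. This yields the nontrivial half of the
  C*-identity for \<open>opn\<close>.\<close>

lemma bnd_if_star_mult:
  assumes adj: "adj T S" and ST: "bnd c (S * T)" shows "bnd (sqrt c) T"
  unfolding bnd_def
proof (intro conjI ballI allI)
  have c: "0 \<le> c" using ST by (simp add: bnd_def)
  then show "0 \<le> sqrt c" by simp
  fix p x assume p: "p \<in> N"
  have "(p (app T x))\<^sup>2 = p (iv x * app S (app T x))"
    using p_star[OF p, of "app T x"] adjD[OF adj, of x "app T x"] by simp
  also have "\<dots> \<le> p x * p (app S (app T x))" using p_mult[OF p, of "iv x"] by (simp add: p_iv[OF p])
  also have "\<dots> \<le> p x * (c * p x)"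
    using bndD[OF ST p, of x] p_nonneg[OF p] by (intro mult_left_mono) auto
  also have "\<dots> = (sqrt c * p x)\<^sup>2" using c by (simp add: power_mult_distrib power2_eq_square)
  finally show "p (app T x) \<le> sqrt c * p x"
    by (rule power2_le_imp_le) (use c p_nonneg[OF p] in simp)
qed

text \<open>The pointwise limit exists by completeness. Convergence is expressed by
  \<open>bnd\<close>, since \<open>bnd_opn\<close> is available only for members of
  \<open>bops\<close> and the limit has no known adjoint yet.\<close>

lemma bops_limit:
  fixes f :: "nat \<Rightarrow> 'a endo"
  assumes cauchy: "\<forall>e>0. \<exists>n0. \<forall>m\<ge>n0. \<forall>n\<ge>n0. opn (f m - f n) < e"
    and fd: "\<And>m n. f m - f n \<in> bops"
  obtains L where "\<And>e. e > 0 \<Longrightarrow> \<exists>n0. \<forall>n\<ge>n0. bnd e (f n - L)"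
proof -
  have est: "p (app (f m) x - app (f n) x) \<le> opn (f m - f n) * p x" if "p \<in> N" for p m n x
    using bndD[OF bnd_opn[OF fd] that, of m n x] by simp
  have "\<exists>l. \<forall>p\<in>N. \<forall>e>0. eventually (\<lambda>n. p (app (f n) x - l) < e) sequentially" for x
  proof (rule seq_complete)
    fix p and e :: real assume p: "p \<in> N" and e: "e > 0"
    have "e / (p x + 1) > 0" using e p_nonneg[OF p, of x] by (simp add: add_nonneg_pos)
    then obtain n0 where n0: "\<forall>m\<ge>n0. \<forall>n\<ge>n0. opn (f m - f n) < e / (p x + 1)"
      using cauchy by blast
    have "p (app (f m) x - app (f n) x) < e" if "m \<ge> n0" "n \<ge> n0" for m n
    proof -
      have "opn (f m - f n) * p x \<le> e / (p x + 1) * p x"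
        using n0 that p_nonneg[OF p, of x] by (intro mult_right_mono) (auto intro: less_imp_le)
      also have "\<dots> < e" using e p_nonneg[OF p, of x] by (simp add: divide_less_eq algebra_simps add_nonneg_pos)
      finally show ?thesis using est[OF p, of m x n] by linarith
    qed
    then show "\<exists>n0. \<forall>m\<ge>n0. \<forall>n\<ge>n0. p (app (f m) x - app (f n) x) < e" by blast
  qed
  then obtain l where l: "\<And>x p e. \<lbrakk>p \<in> N; e > 0\<rbrakk> \<Longrightarrow> eventually (\<lambda>n. p (app (f n) x - l x) < e) sequentially"
    by metis
  have "l (x + y) = l x + l y" for x y
  proof (rule eq_if_sn_le)
    fix p and e :: real assume p: "p \<in> N" and e: "e > 0"
    have "e / 3 > 0" using e by simp
    note ev = l[OF p this]
    obtain n where n: "p (app (f n) x - l x) < e / 3" "p (app (f n) y - l y) < e / 3"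
      "p (app (f n) (x + y) - l (x + y)) < e / 3"
      using eventually_happens'[OF sequentially_bot eventually_conj[OF ev[of x] eventually_conj[OF ev[of y] ev[of "x + y"]]]]
      by blast
    have "l (x + y) - (l x + l y)
        = (app (f n) x - l x) + (app (f n) y - l y) - (app (f n) (x + y) - l (x + y))"
      by (simp add: app_add)
    also have "p \<dots> \<le> p (app (f n) x - l x) + p (app (f n) y - l y) + p (app (f n) (x + y) - l (x + y))"
      by (rule order_trans[OF p_diff[OF p] add_right_mono[OF p_add[OF p]]])
    finally show "p (l (x + y) - (l x + l y)) \<le> e" using n by linarith
  qed
  then have app: "app (Endo l) x = l x" for x by (subst Endo_inverse) auto
  show thesis
  proof
    fix e :: real assume e: "e > 0"
    then obtain n0 where n0: "\<forall>m\<ge>n0. \<forall>n\<ge>n0. opn (f m - f n) < e" using cauchy by blast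
    have "p (app (f n) x - l x) \<le> e * p x" if n: "n \<ge> n0" and p: "p \<in> N" for n p x
    proof (rule field_le_epsilon)
      fix d :: real assume "d > 0"
      then obtain n1 where n1: "\<forall>n\<ge>n1. p (app (f n) x - l x) < d" using l[OF p] unfolding eventually_sequentially by blast
      \<comment> \<open>The index m depends on x, p and d, but the resulting bound e does not, so
        letting d tend to 0 gives a uniform estimate.\<close>
      define m where "m = max n0 n1"
      have "p (app (f n) x - app (f m) x) \<le> opn (f n - f m) * p x" by (rule est[OF p])
      also have "\<dots> \<le> e * p x"
        using n0 n p_nonneg[OF p, of x] by (intro mult_right_mono) (auto simp: m_def intro: less_imp_le)
      finally have "p (app (f n) x - app (f m) x) \<le> e * p x" .
      moreover have "p (app (f m) x - l x) < d" using n1 by (simp add: m_def)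
      ultimately show "p (app (f n) x - l x) \<le> e * p x + d"
        using p_triangle[OF p, of "app (f n) x" "l x" "app (f m) x"] by linarith
    qed
    then show "\<exists>n0. \<forall>n\<ge>n0. bnd e (f n - Endo l)" using e by (auto simp: bnd_def app)
  qed
qed

lemma bopsI: "\<lbrakk>bnd c T; adj T S\<rbrakk> \<Longrightarrow> T \<in> bops"
  by (auto simp: bops_def)

lemma bops_diff: "\<lbrakk>T \<in> bops; S \<in> bops\<rbrakk> \<Longrightarrow> T - S \<in> bops"
  using bnd_diff adj_diff unfolding bops_def by blast

lemma bops_mult: "\<lbrakk>T \<in> bops; S \<in> bops\<rbrakk> \<Longrightarrow> T * S \<in> bops"
  using bnd_mult adj_mult unfolding bops_def by blast

lemma bops_star: "T \<in> bops \<Longrightarrow> star T \<in> bops"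
  using adj_star bnd_adj[OF bnd_opn] adj_sym bopsI by blast

lemma star_star: "T \<in> bops \<Longrightarrow> star (star T) = T"
  by (rule star_eq, rule adj_sym, rule adj_star)

lemma star_diff: "\<lbrakk>T \<in> bops; S \<in> bops\<rbrakk> \<Longrightarrow> star (T - S) = star T - star S"
  by (intro star_eq adj_diff adj_star)

lemma opn_star: "T \<in> bops \<Longrightarrow> opn (star T) = opn T"
proof (rule antisym)
  show *: "opn (star T) \<le> opn T" if "T \<in> bops" for T
    using opn_le bnd_adj[OF bnd_opn] adj_star that by blast
  show "opn T \<le> opn (star T)" if "T \<in> bops"
    using *[OF bops_star[OF that]] star_star[OF that] by simp
qed

lemma adj_limit:
  fixes f :: "nat \<Rightarrow> 'a endo"
  assumes f: "\<And>n. f n \<in> bops"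
    and L: "\<And>e. e > 0 \<Longrightarrow> \<exists>n0. \<forall>n\<ge>n0. bnd e (f n - L)"
    and L': "\<And>e. e > 0 \<Longrightarrow> \<exists>n0. \<forall>n\<ge>n0. bnd e (star (f n) - L')"
  shows "adj L L'"
  unfolding adj_def
proof (intro allI, rule eq_if_sn_le)
  fix x y p and e :: real assume p: "p \<in> N" and e: "e > 0"
  define d where "d = e / (2 * (p x * p y + 1))"
  have xy: "0 \<le> p x * p y" using p_nonneg[OF p] by simp
  then have d: "d > 0" using e by (simp add: d_def add_nonneg_pos)
  obtain n0 n1 where "\<forall>n\<ge>n0. bnd d (f n - L)" "\<forall>n\<ge>n1. bnd d (star (f n) - L')"
    using L[OF d] L'[OF d] by blast
  then have n: "bnd d (f (max n0 n1) - L)" "bnd d (star (f (max n0 n1)) - L')" by simp_all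
  define T where "T = f (max n0 n1)"
  have adj: "adj T (star T)" unfolding T_def by (rule adj_star[OF f])
  have 1: "p (iv (app L x) * y - iv (app T x) * y) \<le> d * p x * p y"
  proof -
    have "iv (app L x) * y - iv (app T x) * y = - (iv (app (T - L) x) * y)"
      by (simp add: iv_diff left_diff_distrib)
    then have "p (iv (app L x) * y - iv (app T x) * y) \<le> p (app (T - L) x) * p y"
      using p_mult[OF p, of "iv (app (T - L) x)" y] by (simp only: p_minus[OF p] p_iv[OF p])
    also have "\<dots> \<le> d * p x * p y"
      using bndD[OF n(1) p, of x] p_nonneg[OF p] unfolding T_def by (intro mult_right_mono)
    finally show ?thesis .
  qed
  have 2: "p (iv x * app (star T) y - iv x * app L' y) \<le> d * p x * p y"
  proof -
    have "iv x * app (star T) y - iv x * app L' y = iv x * app (star T - L') y"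
      by (simp add: right_diff_distrib)
    then have "p (iv x * app (star T) y - iv x * app L' y) \<le> p x * p (app (star T - L') y)"
      using p_mult[OF p, of "iv x" "app (star T - L') y"] by (simp only: p_iv[OF p])
    also have "\<dots> \<le> p x * (d * p y)"
      using bndD[OF n(2) p, of y] p_nonneg[OF p] unfolding T_def by (intro mult_left_mono)
    finally show ?thesis by (simp only: mult_ac)
  qed
  have "p (iv (app L x) * y - iv x * app L' y) \<le> d * p x * p y + d * p x * p y"
    using p_triangle[OF p, of "iv (app L x) * y" "iv x * app L' y" "iv (app T x) * y"] 1 2
    unfolding adjD[OF adj] by linarith
  also have "\<dots> = 2 * d * (p x * p y)" by simp
  also have "\<dots> \<le> 2 * d * (p x * p y + 1)" using d by (intro mult_left_mono) auto
  also have "\<dots> = e" using xy by (simp add: d_def add_nonneg_pos field_simps)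
  finally show "p (iv (app L x) * y - iv x * app L' y) \<le> e" .
qed

text \<open>The adjoints form a Cauchy sequence too because \<open>star\<close> is isometric, and
  their limit is the adjoint of the limit.\<close>

lemma bops_complete:
  fixes f :: "nat \<Rightarrow> 'a endo"
  assumes f: "\<And>n. f n \<in> bops"
    and cauchy: "\<forall>e>0. \<exists>n0. \<forall>m\<ge>n0. \<forall>n\<ge>n0. opn (f m - f n) < e"
  shows "\<exists>L\<in>bops. (\<lambda>n. opn (f n - L)) \<longlonglongrightarrow> 0"
proof -
  obtain L where L: "\<And>e. e > 0 \<Longrightarrow> \<exists>n0. \<forall>n\<ge>n0. bnd e (f n - L)"
    using bops_limit[OF cauchy bops_diff[OF f f]] by blast
  have "opn (star (f m) - star (f n)) = opn (f m - f n)" for m n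
    using star_diff[OF f f] opn_star[OF bops_diff[OF f f]] by metis
  then have cauchy': "\<forall>e>0. \<exists>n0. \<forall>m\<ge>n0. \<forall>n\<ge>n0. opn (star (f m) - star (f n)) < e" using cauchy by simp
  obtain L' where L': "\<And>e. e > 0 \<Longrightarrow> \<exists>n0. \<forall>n\<ge>n0. bnd e (star (f n) - L')"
    using bops_limit[OF cauchy' bops_diff[OF bops_star[OF f] bops_star[OF f]]] by blast
  have adj: "adj L L'" by (rule adj_limit[OF f L L'])
  obtain n where "bnd 1 (f n - L)" using L[of 1] by auto
  then have "bnd (opn (f n) + 1) (f n - (f n - L))" by (intro bnd_diff bnd_opn f)
  then have LB: "L \<in> bops" using adj by (auto intro: bopsI)
  have "(\<lambda>n. opn (f n - L)) \<longlonglongrightarrow> 0"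
  proof (rule LIMSEQ_I)
    fix e :: real assume "e > 0"
    then obtain n0 where n0: "\<forall>n\<ge>n0. bnd (e / 2) (f n - L)" using L[of "e / 2"] by auto
    have "norm (opn (f n - L) - 0) < e" if "n \<ge> n0" for n
      using opn_le[of "e / 2" "f n - L"] n0 that bnd_nonneg[OF bnd_opn[OF bops_diff[OF f LB]], of n] \<open>e > 0\<close>
      by auto
    then show "\<exists>n0. \<forall>n\<ge>n0. norm (opn (f n - L) - 0) < e" by blast
  qed
  then show ?thesis using LB by blast
qed

sublocale cs: unital_cstar bops star opn scop
proof
  show "1 \<in> bops" using bopsI bnd_1 adj_1 .
  show sc: "scop c \<in> bops" for c using bopsI bnd_scop adj_scop .
  show "scop (a + b) = scop a + scop b" "scop (a * b) = scop a * scop b" for a b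
    by (rule endo_eqI, simp add: sm_add_left sm_sm)+
  show "scop 1 = 1" by (rule endo_eqI) simp
  show "T * scop c = scop c * T" if "T \<in> bops" for T c
    by (rule endo_eqI) (simp add: adj_app_sm[OF adj_star[OF that]])
  show "star (scop c) = scop (cnj c)" for c by (rule star_eq[OF adj_scop])
  show "opn T = 0 \<Longrightarrow> T = 0" if T: "T \<in> bops" for T
  proof (rule endo_eqI, simp, rule hausdorff)
    fix x p assume "opn T = 0" and p: "p \<in> N"
    then show "p (app T x) = 0" using bndD[OF bnd_opn[OF T] p, of x] p_nonneg[OF p, of "app T x"] by simp
  qed
  have le: "opn (scop c * T) \<le> cmod c * opn T" if "T \<in> bops" for T c
    by (intro opn_le bnd_mult bnd_scop bnd_opn that)
  show "opn (scop c * T) = cmod c * opn T" if T: "T \<in> bops" for T c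
  proof (rule antisym[OF le[OF T]])
    show "cmod c * opn T \<le> opn (scop c * T)"
    proof (cases "c = 0")
      case True
      then show ?thesis using bnd_nonneg[OF bnd_opn[OF bops_mult[OF sc T]]] by simp
    next
      case False
      have "scop (1 / c) * (scop c * T) = T" using False by (intro endo_eqI) (simp add: sm_sm)
      then have "opn T \<le> cmod (1 / c) * opn (scop c * T)"
        using le[OF bops_mult[OF sc T], of "1 / c" c] by simp
      then show ?thesis using False by (simp add: norm_divide field_simps)
    qed
  qed
  show "opn (star T * T) = (opn T)\<^sup>2" if T: "T \<in> bops" for T
  proof (rule antisym)
    have "opn (star T * T) \<le> opn (star T) * opn T" by (intro opn_le bnd_mult bnd_opn T bops_star)
    then show "opn (star T * T) \<le> (opn T)\<^sup>2" by (simp add: opn_star[OF T] power2_eq_square)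
    have b: "bnd (opn (star T * T)) (star T * T)" by (intro bnd_opn bops_mult bops_star T)
    then have "opn T \<le> sqrt (opn (star T * T))" by (intro opn_le bnd_if_star_mult[OF adj_star[OF T]])
    then have "(opn T)\<^sup>2 \<le> (sqrt (opn (star T * T)))\<^sup>2"
      using bnd_nonneg[OF bnd_opn[OF T]] by (rule power_mono)
    then show "(opn T)\<^sup>2 \<le> opn (star T * T)" using bnd_nonneg[OF b] by simp
  qed
  show "\<exists>l\<in>bops. (\<lambda>n. opn (f n - l)) \<longlonglongrightarrow> 0"
    if "\<And>n. f n \<in> bops" "\<forall>e>0. \<exists>N. \<forall>m\<ge>N. \<forall>n\<ge>N. opn (f m - f n) < e" for f :: "nat \<Rightarrow> 'a endo"
    using bops_complete that by blast
  fix T assume T: "T \<in> bops"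
  show "star T \<in> bops" "star (star T) = T" by (fact bops_star[OF T], fact star_star[OF T])
  show "0 \<le> opn T" by (fact bnd_nonneg[OF bnd_opn[OF T]])
  fix S assume S: "S \<in> bops"
  show "T - S \<in> bops" "T * S \<in> bops" by (fact bops_diff[OF T S], fact bops_mult[OF T S])
  show "star (T + S) = star T + star S" by (intro star_eq adj_add adj_star T S)
  show "star (T * S) = star S * star T" by (intro star_eq adj_mult adj_star T S)
  show "opn (T + S) \<le> opn T + opn S" by (intro opn_le bnd_add bnd_opn T S)
  show "opn (T * S) \<le> opn T * opn S" by (intro opn_le bnd_mult bnd_opn T S)
qed

section \<open>Positive elements of a pro-C*-algebra\<close>

lemma bnd_0: "bnd 0 0"
  by (simp add: bnd_def p_0)

lemma lm_in_bops: "bnd c (lm a) \<Longrightarrow> lm a \<in> bops"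
  using bopsI adj_lm by blast

lemma star_lm: "star (lm a) = lm (iv a)"
  by (rule star_eq[OF adj_lm])

text \<open>Test the bound on \<open>iv a\<close>, where the C*-identity turns the left side into
  the square of \<open>p a\<close>.\<close>

lemma p_le_if_bnd_lm:
  assumes "bnd c (lm a)" "p \<in> N" shows "p a \<le> c"
proof (cases "p a = 0")
  case True
  then show ?thesis using bnd_nonneg[OF assms(1)] by simp
next
  case False
  have "p a * p a \<le> c * p a"
    using bndD[OF assms, of "iv a"] p_star[OF assms(2), of "iv a"]
    by (simp add: p_iv[OF assms(2)] power2_eq_square)
  then show ?thesis using False p_nonneg[OF assms(2), of a] by (simp add: order_less_le)
qed

text \<open>By \<open>p_le_if_bnd_lm\<close> the multipliers d n form a Cauchy sequence in the
  algebra, and multiplication by their limit is T. So left multiplications are closed under uniform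
  limits.\<close>

lemma lm_limit:
  fixes g :: "nat \<Rightarrow> real"
  assumes bnd: "\<And>n. bnd (g n) (lm (d n) - T)" and g: "g \<longlonglongrightarrow> 0"
  shows "\<exists>l. lm l = T"
proof -
  have small: "eventually (\<lambda>n. g n < e) sequentially" if "e > 0" for e
    using order_tendstoD(2)[OF g that] .
  have "\<exists>l. \<forall>p\<in>N. \<forall>e>0. eventually (\<lambda>n. p (d n - l) < e) sequentially"
  proof (rule seq_complete)
    fix p and e :: real assume p: "p \<in> N" and "e > 0"
    then obtain n0 where n0: "\<And>n. n \<ge> n0 \<Longrightarrow> g n < e / 2"
      using small[of "e / 2"] by (auto simp: eventually_sequentially)
    have "p (d m - d n) < e" if "m \<ge> n0" "n \<ge> n0" for m n
    proof -
      have "lm (d m - d n) = (lm (d m) - T) - (lm (d n) - T)" by (simp add: lm_diff)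
      then have "bnd (g m + g n) (lm (d m - d n))" using bnd_diff[OF bnd bnd] by simp
      then have "p (d m - d n) \<le> g m + g n" using p_le_if_bnd_lm p by blast
      then show ?thesis using n0[OF that(1)] n0[OF that(2)] by linarith
    qed
    then show "\<exists>n0. \<forall>m\<ge>n0. \<forall>n\<ge>n0. p (d m - d n) < e" by blast
  qed
  then obtain l where l: "\<And>p e. \<lbrakk>p \<in> N; e > 0\<rbrakk> \<Longrightarrow> eventually (\<lambda>n. p (d n - l) < e) sequentially"
    by blast
  have "app (lm l) x = app T x" for x
  proof (rule eq_if_sn_le)
    fix p and e :: real assume p: "p \<in> N" and e: "e > 0"
    define b where "b = e / (2 * (p x + 1))"
    have px: "p x + 1 > 0" using p_nonneg[OF p, of x] by linarith
    then have b: "b > 0" using e by (simp add: b_def)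
    obtain n where n: "p (d n - l) < b" "g n < b"
      using eventually_happens'[OF sequentially_bot eventually_conj[OF l[OF p b] small[OF b]]] by blast
    have "p (l * x - d n * x) \<le> p (l - d n) * p x"
      using p_mult[OF p, of "l - d n" x] by (simp add: left_diff_distrib)
    also have "\<dots> \<le> b * p x"
      using n p_nonneg[OF p, of x] p_diff_commute[OF p, of l "d n"] by (intro mult_right_mono) auto
    finally have 1: "p (l * x - d n * x) \<le> b * p x" .
    have "p (d n * x - app T x) \<le> g n * p x" using bndD[OF bnd p, of n x] by simp
    also have "\<dots> \<le> b * p x" using n p_nonneg[OF p, of x] by (intro mult_right_mono) auto
    finally have "p (l * x - app T x) \<le> 2 * b * p x"
      using 1 p_triangle[OF p, of "l * x" "app T x" "d n * x"] by linarith
    also have "\<dots> \<le> 2 * b * (p x + 1)" using b by (intro mult_left_mono) auto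
    also have "\<dots> = e" using px by (simp add: b_def field_simps)
    finally show "p (app (lm l) x - app T x) \<le> e" by simp
  qed
  then have "lm l = T" by (rule endo_eqI)
  then show ?thesis by blast
qed

text \<open>The iterates remain in the unitization, scalars plus left multiplications, and the
  scalar part obeys the scalar recursion.\<close>

lemma sqrt_iter_affine:
  assumes "k = 1 - lm a"
  shows "\<exists>c. cs.sqrt_iter k n = cs.rs (sqrt_bound n) + lm c"
proof (induction n)
  case 0
  show ?case by (rule exI[of _ 0]) (simp add: lm_0)
next
  case (Suc n)
  define Y where "Y = complex_of_real (sqrt_bound n)"
  obtain c where c: "cs.sqrt_iter k n = scop Y + lm c" using Suc by (auto simp: Y_def)
  have Y': "complex_of_real (sqrt_bound (Suc n)) = 1/2 + 1/2 * (Y * Y)"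
    by (simp add: Y_def power2_eq_square add_divide_distrib)
  have "cs.sqrt_iter k (Suc n)
      = scop (1/2 + 1/2 * (Y * Y)) + lm (sm (1/2) (sm Y c + sm Y c + c * c - a))"
    unfolding cs.sqrt_iter.simps c
    by (rule endo_eqI) (simp add: assms sm_add sm_diff sm_sm sm_add_left sm_mult_left sm_mult_right
        distrib_left distrib_right left_diff_distrib right_diff_distrib mult.assoc algebra_simps)
  then show ?case unfolding Y' by blast
qed

text \<open>The scalar parts of the iterates tend to 1, so they cancel in the limit 1 - y. This is
  therefore a left multiplication, and the square root lies in the algebra.\<close>

lemma pos_lm_sqrt:
  assumes "cs.pos (lm a)" shows "\<exists>c. iv c = c \<and> c * c = a"
proof -
  obtain t y where y: "t > 0" "y \<in> bops" "star y = y"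
    "(\<lambda>n. opn (cs.sqrt_iter (1 - cs.rs (1 / t) * lm a) n - y)) \<longlonglongrightarrow> 0"
    "cs.rs t * ((1 - y) * (1 - y)) = lm a"
    using cs.pos_sqrt_iter[OF assms] by metis
  define k where "k = 1 - lm (sm (1 / t) a)"
  have kB: "k \<in> bops" using cs.pos_mem[OF assms] by (simp add: k_def lm_sm)
  have lim: "(\<lambda>n. opn (cs.sqrt_iter k n - y)) \<longlonglongrightarrow> 0" using y(4) by (simp add: k_def lm_sm)
  obtain c where c: "\<And>n. cs.sqrt_iter k n = cs.rs (sqrt_bound n) + lm (c n)"
    using sqrt_iter_affine[OF k_def] by metis
  let ?g = "\<lambda>n. opn (cs.sqrt_iter k n - y) + (1 - sqrt_bound n)"
  have "bnd (?g n) (lm (- c n) - (1 - y))" for n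
  proof -
    have "lm (- c n) = - lm (c n)" using lm_diff[of 0 "c n"] by (simp add: lm_0)
    then have eq: "lm (- c n) - (1 - y) = (0 - (cs.sqrt_iter k n - y)) - cs.rs (1 - sqrt_bound n)"
      using cs.sc_diff[of 1 "complex_of_real (sqrt_bound n)"] by (simp add: c)
    have "bnd (0 + opn (cs.sqrt_iter k n - y)) (0 - (cs.sqrt_iter k n - y))"
      using kB y(2) by (intro bnd_diff bnd_opn bnd_0) simp
    moreover have "bnd (1 - sqrt_bound n) (cs.rs (1 - sqrt_bound n))"
      using bnd_scop[of "complex_of_real (1 - sqrt_bound n)"] sqrt_bound_le_one[of n]
      by (simp only: norm_of_real) simp
    ultimately show ?thesis unfolding eq by (auto dest: bnd_diff)
  qed
  moreover have "?g \<longlonglongrightarrow> 0 + (1 - 1)" by (intro tendsto_intros lim sqrt_bound_tendsto)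
  ultimately obtain l where l: "lm l = 1 - y" using lm_limit[of ?g "\<lambda>n. - c n" "1 - y"] by auto
  have "lm (iv l) = star (1 - y)" by (simp flip: l add: star_lm)
  also have "\<dots> = lm l" using y(2,3) by (simp add: l cs.st_diff)
  finally have ivl: "iv l = l" by (simp add: lm_inject)
  let ?r = "sm (sqrt t) l"
  have "iv ?r = ?r" by (simp add: iv_sm ivl)
  moreover have "?r * ?r = a"
  proof -
    have "?r * ?r = sm t (l * l)" using y(1) by (simp add: sm_mult_left sm_mult_right sm_sm flip: of_real_mult)
    moreover have "lm (sm t (l * l)) = lm a" using y(5) by (simp add: lm_sm lm_mult l)
    ultimately show ?thesis by (simp add: lm_inject)
  qed
  ultimately show ?thesis by blast
qed

section \<open>Seminorm estimates and resolvents of self-adjoint elements\<close>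

lemma p_cartesian:
  assumes p: "p \<in> N" and ab: "iv a * b = iv b * a"
  shows "(p a)\<^sup>2 \<le> p (iv a * a + iv b * b)" and "(p b)\<^sup>2 \<le> p (iv a * a + iv b * b)"
proof -
  define Q where "Q = p (iv a * a + iv b * b)"
  \<comment> \<open>The hypothesis cancels the cross terms, so u and v have the same seminorm
    \<open>sqrt Q\<close>; a and i b are half their sum and half their difference.\<close>
  define u v where "u = a + sm \<i> b" and "v = a - sm \<i> b"
  have "iv u * u = iv a * a + iv b * b" "iv v * v = iv a * a + iv b * b"
    using ab by (simp_all add: u_def v_def iv_add iv_diff iv_sm sm_minus_left sm_mult_left sm_mult_right sm_sm
        sm_add sm_diff distrib_left distrib_right left_diff_distrib right_diff_distrib)
  then have "(p u)\<^sup>2 = Q" "(p v)\<^sup>2 = Q" using p_star[OF p] by (simp_all add: Q_def flip: p_star[OF p])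
  then have uv: "p u = sqrt Q" "p v = sqrt Q" using p_nonneg[OF p] by (metis abs_of_nonneg real_sqrt_abs)+
  have Q: "Q \<ge> 0" unfolding Q_def by (rule p_nonneg[OF p])
  have half: "sm (1/2) (w + w) = w" for w
    using sm_add_left[of "1/2" "1/2" w] by (simp add: sm_add)
  have "u + v = a + a" "u - v = sm \<i> b + sm \<i> b" by (simp_all add: u_def v_def)
  then have a: "a = sm (1/2) (u + v)" and b: "sm \<i> b = sm (1/2) (u - v)" by (simp_all only: half)
  have "p a \<le> sqrt Q"
    using arg_cong[OF a, of p] p_sm[OF p, of "1/2" "u + v"] p_add[OF p, of u v] uv by simp
  moreover have "p b \<le> sqrt Q"
    using arg_cong[OF b, of p] p_sm[OF p, of \<i> b] p_sm[OF p, of "1/2" "u - v"] p_diff[OF p, of u v] uv by simp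
  ultimately have "(p a)\<^sup>2 \<le> (sqrt Q)\<^sup>2" "(p b)\<^sup>2 \<le> (sqrt Q)\<^sup>2"
    using p_nonneg[OF p] by (auto intro!: power_mono)
  then show "(p a)\<^sup>2 \<le> p (iv a * a + iv b * b)" "(p b)\<^sup>2 \<le> p (iv a * a + iv b * b)"
    using Q by (simp_all add: Q_def)
qed

text \<open>This is \<open>p_cartesian\<close> for (al + ga h^2) z and be h z. Only the three
  combined coefficients enter Q, so parameters can be tuned to match or remove terms.\<close>

lemma p_quadratic:
  fixes al be ga :: real and z :: 'a
  assumes p: "p \<in> N" and h: "iv h = h"
  defines "Q \<equiv> sm (al\<^sup>2) (iv z * z) + sm (2 * al * ga + be\<^sup>2) (iv z * (h * (h * z)))
    + sm (ga\<^sup>2) (iv z * (h * (h * (h * (h * z)))))"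
  shows "(p (sm al z + sm ga (h * (h * z))))\<^sup>2 \<le> p Q" and "(p (sm be (h * z)))\<^sup>2 \<le> p Q"
proof -
  let ?a = "sm al z + sm ga (h * (h * z))" and ?b = "sm be (h * z)"
  have ab: "iv ?a * ?b = iv ?b * ?a"
    by (simp add: iv_add iv_sm iv_mult h sm_mult_left sm_mult_right sm_sm sm_add distrib_left distrib_right
        mult.assoc) (simp add: mult.commute)
  have eq: "iv ?a * ?a + iv ?b * ?b = Q"
    unfolding Q_def
    by (simp add: iv_add iv_sm iv_mult h sm_mult_left sm_mult_right sm_sm sm_add sm_add_left distrib_left
        distrib_right mult.assoc power2_eq_square) (simp add: mult_ac sm_add_left[of "_ * _" "_ * _", symmetric])
  show "(p ?a)\<^sup>2 \<le> p Q" "(p ?b)\<^sup>2 \<le> p Q" using p_cartesian[OF p ab] unfolding eq by auto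
qed

text \<open>The identity (1 + h^2)^2 = (1 - h^2)^2 + (2 h)^2 lets w = (1 + h^2) z dominate both (1 -
  h^2) z and 2 h z, and z is half of w + (1 - h^2) z.\<close>

lemma p_resolvent_bounds:
  assumes p: "p \<in> N" and h: "iv h = h"
  shows "p z \<le> p (z + h * (h * z))" and "p (h * z) \<le> p (z + h * (h * z))"
proof -
  let ?w = "z + h * (h * z)"
  have "sm 2 x = x + x" for x using sm_add_left[of 1 1 x] by simp
  then have "iv ?w * ?w = sm (1\<^sup>2) (iv z * z) + sm (2 * 1 * (- 1) + 2\<^sup>2) (iv z * (h * (h * z)))
      + sm ((- 1)\<^sup>2) (iv z * (h * (h * (h * (h * z)))))"
    by (simp add: iv_add iv_mult h distrib_left distrib_right mult.assoc)
  then have eq: "p (sm (complex_of_real (1\<^sup>2)) (iv z * z)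
      + sm (complex_of_real (2 * 1 * (- 1) + 2\<^sup>2)) (iv z * (h * (h * z)))
      + sm (complex_of_real ((- 1)\<^sup>2)) (iv z * (h * (h * (h * (h * z)))))) = (p ?w)\<^sup>2"
    using p_star[OF p, of ?w] by simp
  note q = p_quadratic[OF p h, where al = 1 and ga = "- 1" and be = 2 and z = z, unfolded eq]
  have 1: "p (z - h * (h * z)) \<le> p ?w"
    using power2_le_imp_le[OF q(1)] p_nonneg[OF p] by (simp add: sm_minus_left)
  have 2: "2 * p (h * z) \<le> p ?w"
    using power2_le_imp_le[OF q(2)] p_nonneg[OF p] by (simp add: p_sm[OF p])
  then show "p (h * z) \<le> p ?w" using p_nonneg[OF p, of "h * z"] by linarith
  have "z = sm (1/2) (?w + (z - h * (h * z)))"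
    using sm_add_left[of "1/2" "1/2" z] by (simp add: sm_add)
  then have "p z = 1/2 * p (?w + (z - h * (h * z)))"
    using p_sm[OF p, of "1/2" "?w + (z - h * (h * z))"] by simp
  then show "p z \<le> p ?w" using p_add[OF p, of ?w "z - h * (h * z)"] 1 by linarith
qed

lemma p_resolvent_contraction:
  assumes p: "p \<in> N" and h: "iv h = h"
  obtains d where "0 < d" "d \<le> 1"
    "\<And>z. p (z - sm (complex_of_real d) (z + h * (h * z))) \<le> sqrt (1 - d) * p z"
proof -
  define c where "c = p h ^ 4"
  \<comment> \<open>This value makes (1 - d)^2 + c d^2 equal to 1 - d.\<close>
  define d where "d = 1 / (1 + c)"
  have c: "c \<ge> 0" using p_nonneg[OF p] by (simp add: c_def)
  then have d: "0 < d" "d \<le> 1" "d * (1 + c) = 1" by (auto simp: d_def)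
  \<comment> \<open>Chosen to cancel the h^2 term of the quadratic form, leaving only the terms
    without h and with h^4.\<close>
  define b where "b = sqrt (2 * d * (1 - d))"
  have b: "2 * (1 - d) * (- d) + b\<^sup>2 = 0" using d by (simp add: b_def)
  have "p (z - sm (complex_of_real d) (z + h * (h * z))) \<le> sqrt (1 - d) * p z" for z
  proof (rule power2_le_imp_le)
    have hz: "p (h * x) \<le> p h * p x" for x by (rule p_mult[OF p])
    have h1: "p (h * y) \<le> p h * B" if "p y \<le> B" for y B
      using order_trans[OF hz[of y] mult_left_mono[OF that p_nonneg[OF p, of h]]] .
    have "p (h * (h * (h * (h * z)))) \<le> p h * (p h * (p h * (p h * p z)))"
      by (intro h1 order_refl)
    also have "\<dots> = c * p z" by (simp add: c_def eval_nat_numeral)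
    finally have h4: "p (h * (h * (h * (h * z)))) \<le> c * p z" .
    have "z - sm (complex_of_real d) (z + h * (h * z))
        = sm (complex_of_real (1 - d)) z + sm (complex_of_real (- d)) (h * (h * z))"
      by (simp add: sm_add sm_diff_left sm_minus_left)
    then have "(p (z - sm (complex_of_real d) (z + h * (h * z))))\<^sup>2
        \<le> p (sm (complex_of_real ((1 - d)\<^sup>2)) (iv z * z) + sm (complex_of_real 0) (iv z * (h * (h * z)))
          + sm (complex_of_real ((- d)\<^sup>2)) (iv z * (h * (h * (h * (h * z))))))"
      using p_quadratic(1)[OF p h, where al = "1 - d" and ga = "- d" and be = b and z = z] unfolding b by (simp only:)
    also have "\<dots> \<le> p (sm (complex_of_real ((1 - d)\<^sup>2)) (iv z * z))
        + p (sm (complex_of_real (d\<^sup>2)) (iv z * (h * (h * (h * (h * z))))))"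
      using p_add[OF p] by simp
    also have "\<dots> = (1 - d)\<^sup>2 * (p z)\<^sup>2 + d\<^sup>2 * p (iv z * (h * (h * (h * (h * z)))))"
      by (simp only: p_sm[OF p] norm_of_real p_star[OF p]) simp
    also have "p (iv z * (h * (h * (h * (h * z))))) \<le> c * (p z)\<^sup>2"
      using order_trans[OF p_mult[OF p] mult_left_mono[OF h4 p_nonneg[OF p, of "iv z"]]]
      by (simp add: p_iv[OF p] power2_eq_square mult_ac)
    also have "(1 - d)\<^sup>2 * (p z)\<^sup>2 + d\<^sup>2 * (c * (p z)\<^sup>2) = (1 - 2 * d + d * (d * (1 + c))) * (p z)\<^sup>2"
      by (simp add: power2_eq_square algebra_simps)
    also have "\<dots> = (sqrt (1 - d) * p z)\<^sup>2" using d by (simp add: power_mult_distrib)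
    finally show "(p (z - sm (complex_of_real d) (z + h * (h * z))))\<^sup>2 \<le> (sqrt (1 - d) * p z)\<^sup>2"
      using d by (simp add: mult_left_mono)
    show "0 \<le> sqrt (1 - d) * p z" using d p_nonneg[OF p] by simp
  qed
  with d that show thesis by blast
qed

text \<open>Correcting z by d times its residual contracts the residual by the factor
  \<open>sqrt (1 - d)\<close>. The step d depends on p, so the solutions are approximate for one
  seminorm at a time.\<close>

lemma p_resolvent_approx:
  assumes p: "p \<in> N" and h: "iv h = h" and e: "e > 0"
  shows "\<exists>z. p (x - (z + h * (h * z))) < e"
proof -
  obtain d where d: "0 < d" "d \<le> 1"
    "\<And>z. p (z - sm (complex_of_real d) (z + h * (h * z))) \<le> sqrt (1 - d) * p z"
    using p_resolvent_contraction[OF p h] by metis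
  let ?G = "\<lambda>z. z + h * (h * z)" and ?k = "sqrt (1 - d)"
  have "\<exists>z. p (x - ?G z) \<le> ?k ^ n * p x" for n
  proof (induction n)
    case 0
    show ?case by (rule exI[of _ 0]) simp
  next
    case (Suc n)
    then obtain z where z: "p (x - ?G z) \<le> ?k ^ n * p x" by blast
    let ?r = "x - ?G z"
    have eq: "x - ?G (z + sm d ?r) = ?r - sm d (?G ?r)"
      by (simp add: distrib_left sm_add sm_mult_right)
    have "p (x - ?G (z + sm d ?r)) \<le> ?k * p ?r" unfolding eq by (rule d(3))
    also have "\<dots> \<le> ?k * (?k ^ n * p x)" using z d by (intro mult_left_mono) auto
    finally show ?case by (intro exI[of _ "z + sm d ?r"]) (simp add: mult.assoc)
  qed
  moreover have "\<exists>n. ?k ^ n * p x < e"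
  proof -
    have "(\<lambda>n. ?k ^ n * p x) \<longlonglongrightarrow> 0"
      using d by (intro tendsto_mult_left_zero LIMSEQ_power_zero) auto
    from order_tendstoD(2)[OF this e] show ?thesis by (auto simp: eventually_sequentially)
  qed
  ultimately show ?thesis by (meson le_less_trans)
qed

text \<open>Bijectivity of 1 + h^2 comes from \<open>surj_if_bounded_below\<close> and the lower
  bound. The same estimates make E and h E contractions even when h is not uniformly
  bounded.\<close>

lemma resolvent:
  assumes h: "iv h = h"
  obtains E where "adj E E" "bnd 1 E" "bnd 1 (lm h * E)"
    "(1 + lm (h * h)) * E = 1" "E * (1 + lm (h * h)) = 1"
proof -
  define G where "G = 1 + lm (h * h)"
  have G: "app G z = z + h * (h * z)" for z by (simp add: G_def mult.assoc)
  have adjG: "adj G G"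
    using adj_add[OF adj_1 adj_lm[of "h * h"]] by (simp add: G_def iv_mult h)
  have "\<exists>z. app G z = x" for x
  proof (rule surj_if_bounded_below)
    fix p assume p: "p \<in> N"
    show "p z \<le> p (app G z)" for z unfolding G by (rule p_resolvent_bounds[OF p h])
    have "p (app G z) \<le> (1 + p (h * h)) * p z" for z
      using p_add[OF p, of z "h * h * z"] p_mult[OF p, of "h * h" z] by (simp add: G mult.assoc distrib_right)
    then show "\<exists>c. \<forall>z. p (app G z) \<le> c * p z" by blast
    show "\<exists>z. p (x - app G z) < e" if "e > 0" for e
      unfolding G by (rule p_resolvent_approx[OF p h that])
  qed
  then obtain f where f: "\<And>x. app G (f x) = x" by metis
  have inj: "x = y" if "app G x = app G y" for x y
  proof -
    have "p (x - y) = 0" if p: "p \<in> N" for p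
      using p_resolvent_bounds(1)[OF p h, of "x - y"] p_nonneg[OF p, of "x - y"] \<open>app G x = app G y\<close>
      by (simp add: p_0[OF p] app_diff flip: G)
    then show ?thesis using hausdorff[of "x - y"] by simp
  qed
  have "f (x + y) = f x + f y" for x y by (rule inj) (simp add: f app_add)
  then have E: "app (Endo f) x = f x" for x by (subst Endo_inverse) auto
  have "adj (Endo f) (Endo f)"
    unfolding adj_def E
  proof (intro allI)
    fix x y
    show "iv (f x) * y = iv x * f y" using adjD[OF adjG, of "f x" "f y"] by (simp add: f)
  qed
  moreover have "p (f x) \<le> p x" "p (h * f x) \<le> p x" if "p \<in> N" for p x
    using p_resolvent_bounds[OF that h, of "f x"] f[of x] by (simp_all add: G)
  then have "bnd 1 (Endo f)" "bnd 1 (lm h * Endo f)" by (auto simp: bnd_def E)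
  moreover have "G * Endo f = 1" "Endo f * G = 1"
    by (rule endo_eqI, simp add: E f, rule endo_eqI, simp add: E, rule inj, simp add: f)
  ultimately show thesis using that unfolding G_def by blast
qed

text \<open>With h = \<open>iv b * b\<close>, the square of b E is the product of the contractions E
  and h E.\<close>

lemma bnd_lm_resolvent:
  assumes "adj E E" "bnd 1 E" "bnd 1 (lm (iv b * b) * E)" "lm b' = lm b * E"
  shows "bnd 1 (lm b')"
proof -
  have "lm (iv b') * lm b' = E * (lm (iv b * b) * E)"
    using lm_star_conj[OF assms(1,4)] by (simp add: lm_mult mult.assoc)
  then have "bnd 1 (lm (iv b') * lm b')" using bnd_mult[OF assms(2,3)] by simp
  then show ?thesis using bnd_if_star_mult[OF adj_lm] by fastforce
qed

section \<open>Sums and comparison of positive elements\<close>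

lemma iv_star_self: "iv (iv b * b) = iv b * b"
  by (simp add: iv_mult)

lemma adj_one_plus_square: "iv h = h \<Longrightarrow> adj (1 + lm (h * h)) (1 + lm (h * h))"
  using adj_add[OF adj_1 adj_lm[of "h * h"]] by (simp add: iv_mult)

text \<open>Sandwiching \<open>b\<close> and \<open>d\<close> between resolvents makes both uniformly bounded, and the sandwich
  is undone afterwards on the square root.\<close>

lemma star_mult_self_add:
  "\<exists>c. iv b * b + iv d * d = iv c * c"
proof -
  obtain E1 where E1: "adj E1 E1" "bnd 1 E1" "bnd 1 (lm (iv b * b) * E1)"
    "(1 + lm (iv b * b * (iv b * b))) * E1 = 1" "E1 * (1 + lm (iv b * b * (iv b * b))) = 1"
    using resolvent[OF iv_star_self] by metis
  define G1 where "G1 = 1 + lm (iv b * b * (iv b * b))"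
  obtain b1 d1 where b1: "lm b1 = lm b * E1" and d1: "lm d1 = lm d * E1"
    using lm_mult_adj[OF E1(1)] by metis
  \<comment> \<open>E1 makes b bounded but need not do so for d; a second resolvent, built from d
    E1, does this and keeps b bounded.\<close>
  obtain E2 where E2: "adj E2 E2" "bnd 1 E2" "bnd 1 (lm (iv d1 * d1) * E2)"
    "(1 + lm (iv d1 * d1 * (iv d1 * d1))) * E2 = 1" "E2 * (1 + lm (iv d1 * d1 * (iv d1 * d1))) = 1"
    using resolvent[OF iv_star_self] by metis
  define G2 where "G2 = 1 + lm (iv d1 * d1 * (iv d1 * d1))"
  obtain b2 d2 where b2: "lm b2 = lm b1 * E2" and d2: "lm d2 = lm d1 * E2"
    using lm_mult_adj[OF E2(1)] by metis
  have "bnd 1 (lm b1)" using bnd_lm_resolvent[OF E1(1-3) b1] .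
  then have "bnd 1 (lm b2)" using bnd_mult[OF _ E2(2)] by (fastforce simp: b2)
  then have b2B: "lm b2 \<in> bops" by (rule lm_in_bops)
  have "bnd 1 (lm d2)" using bnd_lm_resolvent[OF E2(1-3) d2] .
  then have d2B: "lm d2 \<in> bops" by (rule lm_in_bops)
  have "cs.pos (star (lm b2) * lm b2 + star (lm d2) * lm d2)"
    by (intro cs.pos_add cs.pos_star_mult_self b2B d2B)
  then have "cs.pos (lm (iv b2 * b2 + iv d2 * d2))" by (simp add: star_lm lm_add lm_mult)
  then obtain c where c: "iv c = c" "c * c = iv b2 * b2 + iv d2 * d2" using pos_lm_sqrt by metis
  have T: "adj (E1 * E2) (E2 * E1)" by (intro adj_mult E1 E2)
  have "adj G1 G1" "adj G2 G2" unfolding G1_def G2_def by (intro adj_one_plus_square iv_star_self)+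
  then have S: "adj (G2 * G1) (G1 * G2)" by (intro adj_mult)
  \<comment> \<open>Multiplying the root by G2 G1 cancels the resolvents on both sides of the
    sum.\<close>
  obtain c' where c': "lm c' = lm c * (G2 * G1)" using lm_mult_adj[OF S] by metis
  have GE: "G1 * G2 * (E2 * E1) = 1" "E1 * E2 * (G2 * G1) = 1"
  proof -
    have "G1 * (G2 * E2) * E1 = 1" "E1 * (E2 * G2) * G1 = 1"
      using E1(4,5) E2(4,5) by (simp_all add: G1_def G2_def)
    then show "G1 * G2 * (E2 * E1) = 1" "E1 * E2 * (G2 * G1) = 1" by (simp_all only: mult.assoc)
  qed
  have "lm (iv b2 * b2) = E2 * E1 * lm (iv b * b) * (E1 * E2)"
    by (rule lm_star_conj[OF T]) (simp add: b2 b1 mult.assoc)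
  moreover have "lm (iv d2 * d2) = E2 * E1 * lm (iv d * d) * (E1 * E2)"
    by (rule lm_star_conj[OF T]) (simp add: d2 d1 mult.assoc)
  ultimately have "lm (iv c * c) = E2 * E1 * lm (iv b * b + iv d * d) * (E1 * E2)"
    by (simp add: c lm_add distrib_left distrib_right)
  then have "lm (iv c' * c') = G1 * G2 * (E2 * E1) * lm (iv b * b + iv d * d) * (E1 * E2 * (G2 * G1))"
    using lm_star_conj[OF S c'] by (simp add: mult.assoc)
  also have "\<dots> = lm (iv b * b + iv d * d)" by (simp add: GE)
  finally show ?thesis by (metis lm_inject)
qed

lemma positive_add: "\<lbrakk>positive A x; positive A y\<rbrakk> \<Longrightarrow> positive A (x + y)"
  unfolding positive_def using star_mult_self_add by blast

lemma positive_sm: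
  assumes "positive A x" "c \<ge> 0" shows "positive A (sm (complex_of_real c) x)"
proof -
  obtain b where b: "x = iv b * b" using assms(1) by (auto simp: positive_def)
  have "sm (complex_of_real c) x = iv (sm (sqrt c) b) * sm (sqrt c) b"
    using assms(2) by (simp add: b iv_sm sm_mult_left sm_mult_right sm_sm flip: of_real_mult)
  then show ?thesis unfolding positive_def by blast
qed

text \<open>The resolvent of g bounds u E, and the domination hypothesis carries the bound over to v
  E. The comparison is made for these bounded elements, and the resolvent is then removed from the
  square root.\<close>

lemma positive_diff_if_sn_dominated:
  assumes g: "positive A g" and d: "positive A d" and M: "M > 0"
    and dom: "\<And>p a. p \<in> N \<Longrightarrow> p (a * d * iv a) \<le> M * p (a * g * iv a)"
  shows "positive A (sm (complex_of_real M) g - d)"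
proof -
  obtain u v where u: "g = iv u * u" and v: "d = iv v * v" using g d by (auto simp: positive_def)
  obtain E where E: "adj E E" "bnd 1 E" "bnd 1 (lm g * E)"
    "(1 + lm (g * g)) * E = 1" "E * (1 + lm (g * g)) = 1"
    using resolvent[OF iv_star_self, of u] unfolding u by metis
  obtain u' v' where u': "lm u' = lm u * E" and v': "lm v' = lm v * E"
    using lm_mult_adj[OF E(1)] by metis
  have bu: "bnd 1 (lm u')" using bnd_lm_resolvent[OF E(1,2) _ u'] E(3) by (simp add: u)
  \<comment> \<open>The hypothesis is used at a = \<open>iv (app E x)\<close>.\<close>
  have vu: "(p (v' * x))\<^sup>2 \<le> M * (p (u' * x))\<^sup>2" if p: "p \<in> N" for p x
  proof -
    have *: "(p (w' * x))\<^sup>2 = p (iv (app E x) * (iv w * w) * iv (iv (app E x)))"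
      if "lm w' = lm w * E" for w w'
    proof -
      have "app (lm w') x = app (lm w * E) x" by (simp only: that)
      then have "w' * x = w * app E x" by simp
      then show ?thesis using p_star[OF p, of "w * app E x"] by (simp add: iv_mult mult.assoc)
    qed
    show ?thesis unfolding *[OF u'] *[OF v'] u[symmetric] v[symmetric] by (rule dom[OF p])
  qed
  have sqM: "p (v' * x) \<le> sqrt M * p (u' * x)" if "p \<in> N" for p x
    by (rule power2_le_imp_le) (use vu[OF that, of x] M p_nonneg[OF that] in \<open>auto simp: power_mult_distrib\<close>)
  have "bnd (sqrt M) (lm v')"
    unfolding bnd_def
  proof (intro conjI ballI allI)
    fix p x assume p: "p \<in> N"
    have "sqrt M * p (u' * x) \<le> sqrt M * p x" using bndD[OF bu p, of x] M by (intro mult_left_mono) auto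
    then show "p (app (lm v') x) \<le> sqrt M * p x" using sqM[OF p, of x] by simp
  qed (use M in simp)
  then have uB: "lm u' \<in> bops" and vB: "lm v' \<in> bops" using bu lm_in_bops by blast+
  have "cs.pos (cs.rs M * (star (lm u') * lm u') - star (lm v') * lm v')"
  proof (rule cs.pos_diff_if_norm_dominated)
    fix T assume T: "T \<in> bops"
    \<comment> \<open>By the C*-identity, the required norm domination reduces to comparing v' T
      with u' T pointwise.\<close>
    have sq: "opn (star T * (star (lm w) * lm w * T)) = (opn (lm w * T))\<^sup>2" if "lm w \<in> bops" for w
      using cs.nm_star[OF bops_mult[OF that T]] cs.st_mult[OF that T] by (simp add: mult.assoc)
    have b: "bnd (opn (lm u' * T)) (lm u' * T)" by (intro bnd_opn bops_mult uB T)
    have "bnd (sqrt M * opn (lm u' * T)) (lm v' * T)"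
      unfolding bnd_def
    proof (intro conjI ballI allI)
      show "0 \<le> sqrt M * opn (lm u' * T)" using M bnd_nonneg[OF b] by simp
      fix p x assume p: "p \<in> N"
      have "p (app (lm v' * T) x) \<le> sqrt M * p (u' * app T x)" using sqM[OF p, of "app T x"] by simp
      also have "\<dots> \<le> sqrt M * (opn (lm u' * T) * p x)"
        using bndD[OF b p, of x] M by (intro mult_left_mono) auto
      finally show "p (app (lm v' * T) x) \<le> sqrt M * opn (lm u' * T) * p x" by (simp add: mult.assoc)
    qed
    then have "opn (lm v' * T) \<le> sqrt M * opn (lm u' * T)" by (rule opn_le)
    then have "(opn (lm v' * T))\<^sup>2 \<le> (sqrt M * opn (lm u' * T))\<^sup>2"
      using bnd_nonneg[OF bnd_opn[OF bops_mult[OF vB T]]] by (rule power_mono)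
    then show "opn (star T * (star (lm v') * lm v' * T)) \<le> M * opn (star T * (star (lm u') * lm u' * T))"
      unfolding sq[OF uB] sq[OF vB] using M by (simp add: power_mult_distrib)
  qed (intro cs.pos_star_mult_self uB vB M)+
  then have "cs.pos (lm (sm (complex_of_real M) (iv u' * u') - iv v' * v'))"
    by (simp add: star_lm lm_diff lm_sm lm_mult)
  then obtain c where c: "iv c = c" "c * c = sm (complex_of_real M) (iv u' * u') - iv v' * v'"
    using pos_lm_sqrt by metis
  define G where "G = 1 + lm (g * g)"
  have G: "adj G G" unfolding G_def by (rule adj_one_plus_square) (simp add: u iv_star_self)
  have sE: "cs.rs M * E = E * cs.rs M" by (rule endo_eqI) (simp add: adj_app_sm[OF E(1)])
  have "lm (iv c * c) = cs.rs M * (E * lm g * E) - E * lm d * E"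
    using lm_star_conj[OF E(1) u'] lm_star_conj[OF E(1) v'] by (simp add: c lm_diff lm_sm u v)
  also have "\<dots> = E * (cs.rs M * lm g - lm d) * E"
    using arg_cong[OF sE, of "\<lambda>x. x * (lm g * E)"]
    by (simp add: left_diff_distrib right_diff_distrib mult.assoc)
  finally have cE: "lm (iv c * c) = E * lm (sm (complex_of_real M) g - d) * E" by (simp add: lm_diff lm_sm)
  obtain c' where c': "lm c' = lm c * G" using lm_mult_adj[OF G] by metis
  have "lm (iv c' * c') = (G * E) * lm (sm (complex_of_real M) g - d) * (E * G)"
    using lm_star_conj[OF G c'] cE by (simp only: mult.assoc)
  also have "\<dots> = lm (sm (complex_of_real M) g - d)" using E(4,5) by (simp add: G_def)
  finally show ?thesis unfolding positive_def by (metis lm_inject)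
qed

end

section \<open>Transfer of the frame bounds\<close>

theorem theorem4p3:
  fixes A :: "'a::ring pro_alg" and X :: "('a, 'x::ab_group_add) hmod"
    and K Kadj Kinv Kinvadj :: "'x \<Rightarrow> 'x"
    and I :: "'i set" and \<Xi> :: "'i \<Rightarrow> ('a \<Rightarrow> 'x) \<times> ('x \<Rightarrow> 'a)"
  assumes "hilbert_module A X"
    and "in_Hom_adj A X K Kadj"
    and "in_Hom_adj A X Kinv Kinvadj"
    and "\<forall>\<xi>. K (Kinv \<xi>) = \<xi> \<and> Kinv (K \<xi>) = \<xi>"
    and "uniformly_bounded A X K"
    and "uniformly_bounded A X Kinv"
    and "frame_of_multipliers A X I \<Xi>"
  shows "K_frame A X Kadj I \<Xi>"
proof -
  interpret pro_cstar A using assms(1) by unfold_locales (simp add: hilbert_module_def)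
  have ip_add: "ip X (x + y) z = ip X x z + ip X y z"
    and ip_asm: "ip X (asm X a x) y = a * ip X x y"
    and ip_csm: "ip X (csm X c x) y = sm c (ip X x y)"
    and ip_iv: "iv (ip X x y) = ip X y x"
    and ip_pos: "positive A (ip X x x)" for x y z a c
    using assms(1) unfolding hilbert_module_def by metis+
  have K_asm: "K (asm X a x) = asm X a (K x)" and K_adj: "ip X (K x) y = ip X x (Kadj y)" for a x y
    using assms(2) unfolding in_Hom_adj_def module_map_XX_def by metis+
  have ip_add_right: "ip X z (x + y) = ip X z x + ip X z y"
    and ip_csm_right: "ip X x (csm X c y) = sm (cnj c) (ip X x y)"
    and ip_asm_right: "ip X x (asm X a y) = ip X x y * iv a" for x y z c a
    using arg_cong[OF ip_add[of x y z], of iv] arg_cong[OF ip_csm[of c y x], of iv]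
      arg_cong[OF ip_asm[of a y x], of iv]
    by (simp_all add: ip_iv iv_add iv_sm iv_mult)

  obtain C where C: "C > 0" "\<And>p x. p \<in> sn A \<Longrightarrow> pbar X p (K x) \<le> C * pbar X p x"
    using assms(5) by (auto simp: uniformly_bounded_def)
  define M where "M = C\<^sup>2"
  have M: "M > 0" using C(1) by (simp add: M_def)
  have dom: "p (ip X (K x) (K x)) \<le> M * p (ip X x x)" if p: "p \<in> sn A" for p x
  proof -
    have "(pbar X p (K x))\<^sup>2 \<le> (C * pbar X p x)\<^sup>2"
      using C(2)[OF p, of x] p_nonneg[OF p] by (intro power_mono) (auto simp: pbar_def)
    then show ?thesis using p_nonneg[OF p] by (simp add: pbar_def M_def power_mult_distrib)
  qed
  \<comment> \<open>Module linearity supplies the tests: replacing x by a x multiplies both inner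
    products by a on the left and \<open>iv a\<close> on the right.\<close>
  have K_dom: "positive A (sm (complex_of_real M) (ip X x x) - ip X (K x) (K x))" for x
  proof (rule positive_diff_if_sn_dominated[OF ip_pos ip_pos M])
    fix p a assume "p \<in> sn A"
    then show "p (a * ip X (K x) (K x) * iv a) \<le> M * p (a * ip X x x * iv a)"
      using dom[of p "asm X a x"] by (simp add: K_asm ip_asm ip_asm_right mult.assoc)
  qed

  have Kadj_dom: "positive A (sm (complex_of_real M) (ip X x x) - ip X (Kadj x) (Kadj x))" for x
  proof -
    let ?m = "complex_of_real M" and ?y = "Kadj x"
    \<comment> \<open>This is (M - T) x for T = K K^*. The adjoint relation turns the cross terms
      into inner products of y = K^* x with itself.\<close>
    let ?w = "csm X ?m x + csm X (- 1) (K ?y)"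
    have adj': "ip X x (K ?y) = ip X ?y ?y"
      using arg_cong[OF K_adj[of ?y x], of iv] by (simp add: ip_iv)
    have "ip X ?w ?w + (sm ?m (ip X ?y ?y) - ip X (K ?y) (K ?y))
        = sm ?m (sm ?m (ip X x x) - ip X ?y ?y)"
      by (simp add: ip_add ip_add_right ip_csm ip_csm_right sm_minus_left K_adj[of ?y x] adj' sm_add sm_diff sm_minus)
    then have "positive A (sm ?m (sm ?m (ip X x x) - ip X ?y ?y))"
      using positive_add[OF ip_pos[of ?w] K_dom[of ?y]] by simp
    then have "positive A (sm (complex_of_real (1 / M)) (sm ?m (sm ?m (ip X x x) - ip X ?y ?y)))"
      by (rule positive_sm) (use M in simp)
    then show ?thesis using M by (simp add: sm_sm)
  qed

  obtain c d where cd: "c > 0" "d > 0" "\<And>\<xi>. \<exists>s. has_sum_in A (frame_term A \<Xi> \<xi>) I s \<and>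
      pleq A (sm (complex_of_real c) (ip X \<xi> \<xi>)) s \<and> pleq A s (sm (complex_of_real d) (ip X \<xi> \<xi>))"
    and I: "countable I" "\<forall>i\<in>I. is_multiplier A X (\<Xi> i)"
    using assms(7) unfolding frame_of_multipliers_def by blast
  \<comment> \<open>The constant c / M makes c times the inner product of x with itself cancel
    between the old lower bound and the scaled \<open>Kadj_dom\<close>; the upper bound d is
    kept.\<close>
  have lower: "pleq A (sm (complex_of_real (c / M)) (ip X (Kadj \<xi>) (Kadj \<xi>))) s"
    if "pleq A (sm (complex_of_real c) (ip X \<xi> \<xi>)) s" for \<xi> s
  proof -
    have "positive A (sm (complex_of_real (c / M))
        (sm (complex_of_real M) (ip X \<xi> \<xi>) - ip X (Kadj \<xi>) (Kadj \<xi>)))"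
      using cd M by (intro positive_sm Kadj_dom) auto
    with that have "positive A ((s - sm (complex_of_real c) (ip X \<xi> \<xi>)) + sm (complex_of_real (c / M))
        (sm (complex_of_real M) (ip X \<xi> \<xi>) - ip X (Kadj \<xi>) (Kadj \<xi>)))"
      unfolding pleq_def by (rule positive_add)
    then show ?thesis using M by (simp add: pleq_def sm_diff sm_sm)
  qed
  have "\<exists>a b. a > 0 \<and> b > 0 \<and> (\<forall>\<xi>. \<exists>s. has_sum_in A (frame_term A \<Xi> \<xi>) I s \<and>
      pleq A (sm (complex_of_real a) (ip X (Kadj \<xi>) (Kadj \<xi>))) s \<and>
      pleq A s (sm (complex_of_real b) (ip X \<xi> \<xi>)))"
    using cd lower M by (intro exI[of _ "c / M"] exI[of _ d] conjI allI) (auto, blast)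
  then show ?thesis using I unfolding K_frame_def by blast
qed

end
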